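(* Let $K$ be a field of characteristic $p$ and let $G$ be a locally finite $p'$-group. If $KG$ has the property $\mathcal{P}_1$ with respect to some non-zero polynomial $g\in K[T]$, then $KG$ satisfies a standard polynomial identity.
   Context: $KG$ is the group algebra of $G$ with coefficients in $K$. The characteristic $p$ may be $0$; a $p'$-group is a torsion group with no elements of order $p$ (when $p=0$, this is no restriction on a locally finite group). For a polynomial $g\in K[T]$ in one variable, a $K$-algebra $A$ has the property $\mathcal{P}_1$ with respect to $g$ if $g(ab)=0$ for all $a,b\in A$ with $a^2=0=b^2$. The standard polynomial of degree $n\geq 1$ is $S_n(X_1,\dots,X_n)=\sum_{\sigma\in \mathrm{Sym}(n)}\mathrm{sgn}(\sigma)X_{\sigma(1)}\cdots X_{\sigma(n)}$; an algebra $A$ satisfies a standard polynomial identity if for some $n$ one has $S_n(a_1,\dots,a_n)=0$ for all $a_1,\dots,a_n\in A$. *)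

theory Defs
  imports
    "HOL-Algebra.Generated_Groups"
    "HOL-Algebra.Multiplicative_Group"
    "HOL-Combinatorics.Permutations"
    "HOL-Computational_Algebra.Polynomial"
    "HOL-Library.Poly_Mapping"
begin

text \<open>
  Not necessarily commutative groups are represented by types of class \<open>group_add\<close>, whose
  group operation is written additively. This makes \<open>'g \<Rightarrow>\<^sub>0 'k\<close>, with the convolution product of
  \<open>Poly_Mapping\<close>, the group algebra: \<open>single x 1\<close> is the basis element of the group element
  \<open>x\<close>, and \<open>single x a * single y b = single (x + y) (a * b)\<close>.
\<close>

type_synonym ('k, 'g) group_algebra = "'g \<Rightarrow>\<^sub>0 'k"

definition ga_scale :: "'k::field \<Rightarrow> ('k, 'g::group_add) group_algebra \<Rightarrow> ('k, 'g) group_algebra"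
  where "ga_scale c a = Poly_Mapping.map ((*) c) a"

text \<open>The group underlying the type \<open>'g\<close>, for use with the notions of \<open>HOL-Algebra\<close>.\<close>

definition type_group :: "'g::group_add monoid"
  where "type_group = \<lparr>carrier = UNIV, monoid.mult = (+), one = 0\<rparr>"

lemma group_type_group: "group (type_group :: 'g::group_add monoid)"
  by (rule groupI) (auto simp: type_group_def add.assoc intro: left_minus)

definition locally_finite_group :: "('a, 'b) monoid_scheme \<Rightarrow> bool"
  where "locally_finite_group G \<longleftrightarrow>
    (\<forall>S. finite S \<and> S \<subseteq> carrier G \<longrightarrow> finite (generate G S))"

definition torsion_group :: "('a, 'b) monoid_scheme \<Rightarrow> bool"
  where "torsion_group G \<longleftrightarrow>
    (\<forall>x \<in> carrier G. \<exists>n::nat. n > 0 \<and> x [^]\<^bsub>G\<^esub> n = \<one>\<^bsub>G\<^esub>)"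

text \<open>
  \<open>group.ord\<close> is \<open>0\<close> only on elements of infinite order, so for \<open>p = 0\<close> this is just
  \<open>torsion_group\<close>.
\<close>

definition p_prime_group :: "nat \<Rightarrow> ('a, 'b) monoid_scheme \<Rightarrow> bool"
  where "p_prime_group p G \<longleftrightarrow>
    torsion_group G \<and> (\<forall>x \<in> carrier G. group.ord G x \<noteq> p)"

text \<open>
  A \<open>K\<close>-algebra is a type of class \<open>ring_1\<close> together with a scalar multiplication \<open>scale\<close>.
  The library's \<open>poly\<close> evaluates a polynomial only at elements of its coefficient ring.
\<close>

definition alg_poly :: "('k::field \<Rightarrow> 'a::ring_1 \<Rightarrow> 'a) \<Rightarrow> 'k poly \<Rightarrow> 'a \<Rightarrow> 'a"
  where "alg_poly scale g x = (\<Sum>i \<le> Polynomial.degree g. scale (Polynomial.coeff g i) (x ^ i))"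

definition property_P1 :: "('k::field \<Rightarrow> 'a::ring_1 \<Rightarrow> 'a) \<Rightarrow> 'k poly \<Rightarrow> bool"
  where "property_P1 scale g \<longleftrightarrow>
    (\<forall>a b. a ^ 2 = 0 \<and> b ^ 2 = 0 \<longrightarrow> alg_poly scale g (a * b) = 0)"

definition standard_poly :: "nat \<Rightarrow> (nat \<Rightarrow> 'a::ring_1) \<Rightarrow> 'a"
  where "standard_poly n a =
    (\<Sum>\<sigma> | \<sigma> permutes {1..n}. of_int (sign \<sigma>) * prod_list (map (\<lambda>i. a (\<sigma> i)) [1..<Suc n]))"

definition satisfies_standard_identity :: "'a::ring_1 itself \<Rightarrow> bool"
  where "satisfies_standard_identity _ \<longleftrightarrow>
    (\<exists>n \<ge> 1. \<forall>a :: nat \<Rightarrow> 'a. standard_poly n a = 0)"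

end

theory Submission
  imports Defs "HOL-Algebra.Sylow" "HOL-Number_Theory.Residues"
begin

text \<open>
  By Maschke's averaging argument, \<open>K[H]\<close> is von Neumann regular for every finite subgroup \<open>H\<close>
  of \<open>G\<close>, hence so is \<open>KG\<close>.

  If \<open>K\<close> is infinite, replacing \<open>a\<close> by \<open>t a\<close> with \<open>t \<in> K\<close> shows that the product of two
  square-zero elements is nilpotent. For an idempotent \<open>e\<close> this kills \<open>e KG (1 - e)\<close>, so
  idempotents are central. Applied to the averages over cyclic subgroups, it shows that all
  cyclic subgroups of \<open>G\<close> are normal. As in the classification of Hamiltonian groups, the centre
  of \<open>G\<close> then has index at most \<open>4\<close>, so \<open>KG\<close> is spanned by four elements over its centre and
  \<open>S\<^sub>5\<close> vanishes.

  If \<open>K\<close> is finite, \<open>K[H]\<close> is a finite ring. For a primitive idempotent \<open>f\<close> of \<open>A = K[H]\<close> the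
  corner \<open>f A f\<close> is a finite division ring, hence a field by Wedderburn's little theorem, and
  \<open>A\<close> acts on the vector space \<open>A f\<close> over it. Its dimension is at most twice the degree of
  \<open>g\<close>, since otherwise a product of two square-zero matrices can be a Jordan block on
  which \<open>g\<close> does not vanish. So a standard polynomial of degree depending only on \<open>g\<close> annihilates
  all \<open>A f\<close>, and thus vanishes on \<open>A\<close>.
\<close>

section \<open>Vanishing of standard polynomials\<close>

text \<open>The split on \<open>K\<close> is forced. Over a finite field a nonzero \<open>g\<close>
  can vanish on a whole matrix algebra: some \<open>T ^ i - T ^ j\<close> with \<open>i < j\<close>
  annihilates every element of a finite ring. Products of square-zero elements then need not be
  nilpotent, and noncommutativity can only be bounded. Both degrees come from one fact: a
  multilinear alternating polynomial of degree \<open>n\<close> vanishes on combinations of fewer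
  than \<open>n\<close> elements whose coefficients commute with one another and with these
  elements. At most four coset representatives of the centre give 5; at most (2 deg g)^2 matrix
  units on \<open>A f\<close> give (2 deg g)^2 + 1. The second application is where the corner has
  to be commutative. Finitely many elements of \<open>KG\<close> lie in one \<open>K[H]\<close>, so
  a degree independent of \<open>H\<close> is enough. Relations of the form b a = l a b drive both
  Wedderburn's theorem and the Hamiltonian argument. In both, the exponent n(n+1)/2 that appears in
  (b c)^n separates the prime 2 from the odd primes.\<close>

lemma commute_prod_list:
  fixes x :: "'a::monoid_mult"
  assumes "\<And>y. y \<in> set ys \<Longrightarrow> x * y = y * x"
  shows "x * prod_list ys = prod_list ys * x"
  using assms
proof (induction ys)
  case (Cons y ys)
  then have "x * y = y * x" "x * prod_list ys = prod_list ys * x" by auto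
  then have "x * y * prod_list ys = y * prod_list ys * x" by (simp add: mult.assoc)
  then show ?case by (simp add: mult.assoc)
qed simp

lemma prod_list_commuting_permute:
  fixes xs ys :: "'a::monoid_mult list"
  assumes "mset xs = mset ys"
    and "\<And>x y. x \<in> set xs \<Longrightarrow> y \<in> set xs \<Longrightarrow> x * y = y * x"
  shows "prod_list xs = prod_list ys"
  using assms
proof (induction xs arbitrary: ys)
  case (Cons x xs)
  then have "x \<in> set ys" by (metis list.set_intros(1) mset_eq_setD)
  then obtain as bs where ys: "ys = as @ x # bs" by (meson split_list)
  then have "mset xs = mset (as @ bs)" using Cons.prems(1) by simp
  then have IH: "prod_list xs = prod_list (as @ bs)"
    using Cons.prems(2) by (intro Cons.IH) auto
  have "set as \<subseteq> set (x # xs)" using ys Cons.prems(1) by (metis mset_eq_setD set_append Un_upper1)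
  then have "x * prod_list as = prod_list as * x"
    using Cons.prems(2) by (intro commute_prod_list) auto
  with IH show ?case unfolding ys by (simp flip: mult.assoc)
qed simp

lemma prod_list_distrib_sum:
  fixes F :: "'t \<Rightarrow> 'i \<Rightarrow> 'a::semiring_1"
  assumes "finite T" "distinct xs"
  shows "prod_list (map (\<lambda>i. \<Sum>t\<in>T. F t i) xs)
    = (\<Sum>\<tau> \<in> PiE (set xs) (\<lambda>_. T). prod_list (map (\<lambda>i. F (\<tau> i) i) xs))"
  using assms(2)
proof (induction xs)
  case Nil
  then show ?case by simp
next
  case (Cons x xs)
  have "(\<Sum>\<tau> \<in> PiE (set (x # xs)) (\<lambda>_. T). prod_list (map (\<lambda>i. F (\<tau> i) i) (x # xs)))
    = (\<Sum>(t, \<tau>) \<in> T \<times> PiE (set xs) (\<lambda>_. T). prod_list (map (\<lambda>i. F ((\<tau>(x := t)) i) i) (x # xs)))"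
    unfolding list.set PiE_insert_eq
    by (subst sum.reindex) (use Cons.prems in \<open>auto intro!: inj_combinator simp: case_prod_beta\<close>)
  also have "\<dots> = (\<Sum>(t, \<tau>) \<in> T \<times> PiE (set xs) (\<lambda>_. T). F t x * prod_list (map (\<lambda>i. F (\<tau> i) i) xs))"
  proof (intro sum.cong refl, clarify)
    fix t \<tau>
    have eq: "map (\<lambda>i. F ((\<tau>(x := t)) i) i) xs = map (\<lambda>i. F (\<tau> i) i) xs"
      using Cons.prems by auto
    show "prod_list (map (\<lambda>i. F ((\<tau>(x := t)) i) i) (x # xs)) = F t x * prod_list (map (\<lambda>i. F (\<tau> i) i) xs)"
      unfolding list.map prod_list.Cons eq by simp
  qed
  also have "\<dots> = (\<Sum>t\<in>T. F t x) * (\<Sum>\<tau> \<in> PiE (set xs) (\<lambda>_. T). prod_list (map (\<lambda>i. F (\<tau> i) i) xs))"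
    by (simp add: sum_product sum.cartesian_product)
  finally show ?case using Cons by simp
qed

lemma prod_list_mult_commuting:
  fixes f g :: "'i \<Rightarrow> 'a::monoid_mult"
  assumes "\<And>i j. i \<in> set xs \<Longrightarrow> j \<in> set xs \<Longrightarrow> f i * g j = g j * f i"
  shows "prod_list (map (\<lambda>i. f i * g i) xs) = prod_list (map f xs) * prod_list (map g xs)"
  using assms
proof (induction xs)
  case (Cons x xs)
  have "g x * prod_list (map f xs) = prod_list (map f xs) * g x"
    by (rule commute_prod_list) (use Cons.prems in force)
  then have "g x * (prod_list (map f xs) * w) = prod_list (map f xs) * (g x * w)" for w
    by (simp flip: mult.assoc)
  moreover have "prod_list (map (\<lambda>i. f i * g i) xs) = prod_list (map f xs) * prod_list (map g xs)"
    using Cons.prems by (intro Cons.IH) auto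
  ultimately show ?case by (simp add: mult.assoc)
qed simp

text \<open>If \<open>\<tau> i = \<tau> j\<close>, composing \<open>\<sigma>\<close> with the
  transposition of \<open>i\<close> and \<open>j\<close> only reorders commuting factors but flips
  the sign. Even permutations are matched with odd ones, instead of concluding that the sum equals
  its own negative, so characteristic 2 is covered.\<close>

lemma alternating_sum_eq_0:
  fixes M :: "nat \<Rightarrow> 't \<Rightarrow> 'a::ring_1"
  assumes comm: "\<And>i j t u. i \<in> {1..n} \<Longrightarrow> j \<in> {1..n} \<Longrightarrow> t \<in> T \<Longrightarrow> u \<in> T \<Longrightarrow> M i t * M j u = M j u * M i t"
    and \<tau>: "\<tau> \<in> {1..n} \<rightarrow> T" "\<not> inj_on \<tau> {1..n}"
  shows "(\<Sum>\<sigma> | \<sigma> permutes {1..n}. of_int (sign \<sigma>) * prod_list (map (\<lambda>i. M (\<sigma> i) (\<tau> i)) [1..<Suc n])) = 0"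
    (is "sum ?f _ = 0")
proof -
  note upt_Suc [simp del]
  obtain i j where ij: "i \<in> {1..n}" "j \<in> {1..n}" "i \<noteq> j" "\<tau> i = \<tau> j"
    using \<tau>(2) by (auto simp: inj_on_def)
  define t where "t = transpose i j"
  have t: "t permutes {1..n}" unfolding t_def using ij by (intro permutes_swap_id) auto
  have perm: "permutation \<sigma>" if "\<sigma> permutes {1..n}" for \<sigma>
    using that by (rule permutes_imp_permutation[rotated]) simp
  have \<tau>t: "\<tau> (t k) = \<tau> k" for k
    using ij by (auto simp: t_def transpose_def)
  have neg: "?f (\<sigma> \<circ> t) = - ?f \<sigma>" if \<sigma>: "\<sigma> permutes {1..n}" for \<sigma>
  proof -
    let ?xs = "[1..<Suc n]"
    have xs: "set ?xs = {1..n}" by auto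
    have "mset (map t ?xs) = mset ?xs"
      using permutes_image[OF t] permutes_inj_on[OF t]
      by (intro set_eq_iff_mset_eq_distinct[THEN iffD1]) (simp_all only: distinct_map distinct_upt set_map xs simp_thms)
    then have "mset (map (\<lambda>i. M (\<sigma> i) (\<tau> i)) (map t ?xs)) = mset (map (\<lambda>i. M (\<sigma> i) (\<tau> i)) ?xs)"
      by (metis mset_map)
    moreover have "set (map (\<lambda>i. M (\<sigma> i) (\<tau> i)) (map t ?xs)) \<subseteq> {M i u |i u. i \<in> {1..n} \<and> u \<in> T}"
      using \<tau>(1) permutes_in_image[OF \<sigma>] permutes_in_image[OF t] by (fastforce simp only: set_map xs image_image)
    ultimately have 1: "prod_list (map (\<lambda>i. M (\<sigma> i) (\<tau> i)) (map t ?xs)) = prod_list (map (\<lambda>i. M (\<sigma> i) (\<tau> i)) ?xs)"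
      using comm by (intro prod_list_commuting_permute) blast+
    have 2: "map (\<lambda>i. M ((\<sigma> \<circ> t) i) (\<tau> i)) ?xs = map (\<lambda>i. M (\<sigma> i) (\<tau> i)) (map t ?xs)"
      by (simp add: \<tau>t)
    have 3: "sign (\<sigma> \<circ> t) = - sign \<sigma>"
      using sign_compose[of \<sigma> t] perm[OF \<sigma>] perm[OF t] ij(3) by (simp add: t_def sign_swap_id)
    show ?thesis unfolding 1 2 3 by simp
  qed
  have tt: "t \<circ> t = id" by (auto simp: t_def)
  let ?P = "{\<sigma>. \<sigma> permutes {1..n}}"
  have ev: "evenperm (\<sigma> \<circ> t) \<longleftrightarrow> \<not> evenperm \<sigma>" if "\<sigma> permutes {1..n}" for \<sigma>
    using evenperm_comp[of \<sigma> t] perm[OF that] perm[OF t] ij(3) by (simp add: t_def evenperm_swap)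
  have "?P = {\<sigma> \<in> ?P. evenperm \<sigma>} \<union> {\<sigma> \<in> ?P. \<not> evenperm \<sigma>}" by blast
  then have "sum ?f ?P = sum ?f ({\<sigma> \<in> ?P. evenperm \<sigma>} \<union> {\<sigma> \<in> ?P. \<not> evenperm \<sigma>})"
    by (rule arg_cong)
  also have "\<dots> = sum ?f {\<sigma> \<in> ?P. evenperm \<sigma>} + sum ?f {\<sigma> \<in> ?P. \<not> evenperm \<sigma>}"
    by (rule sum.union_disjoint) (simp_all add: finite_permutations disjoint_iff)
  also have "sum ?f {\<sigma> \<in> ?P. \<not> evenperm \<sigma>} = (\<Sum>\<sigma> | \<sigma> \<in> ?P \<and> evenperm \<sigma>. ?f (\<sigma> \<circ> t))"
  proof (rule sum.reindex_bij_witness[of _ "\<lambda>\<sigma>. \<sigma> \<circ> t" "\<lambda>\<sigma>. \<sigma> \<circ> t"])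
    fix \<sigma>
    assume "\<sigma> \<in> {\<sigma> \<in> ?P. \<not> evenperm \<sigma>}"
    then show "\<sigma> \<circ> t \<in> {\<sigma>. \<sigma> \<in> ?P \<and> evenperm \<sigma>}"
      using ev[of \<sigma>] permutes_compose[OF t] by auto
  next
    fix \<sigma>
    assume "\<sigma> \<in> {\<sigma>. \<sigma> \<in> ?P \<and> evenperm \<sigma>}"
    then show "\<sigma> \<circ> t \<in> {\<sigma> \<in> ?P. \<not> evenperm \<sigma>}"
      using ev[of \<sigma>] permutes_compose[OF t] by auto
  qed (simp_all only: o_assoc[symmetric] tt comp_id)
  also have "\<dots> = - sum ?f {\<sigma> \<in> ?P. evenperm \<sigma>}"
    unfolding sum_negf[symmetric] by (intro sum.cong refl neg) simp
  finally show ?thesis by simp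
qed

text \<open>After expansion, position \<open>i\<close> carries \<open>b (\<tau> i)\<close> whatever
  \<open>\<sigma>\<close> is. So the product of the \<open>b\<close>, which need not commute with
  each other, factors out and the alternation takes place among the \<open>z\<close> alone. A map
  \<open>\<tau>\<close> from \<open>n\<close> positions to fewer than \<open>n\<close> elements
  repeats a value.\<close>

lemma standard_poly_eq_0_of_central_span:
  fixes a :: "nat \<Rightarrow> 'a::ring_1"
  assumes T: "finite T" "card T < n"
    and a: "\<And>i. i \<in> {1..n} \<Longrightarrow> a i = (\<Sum>t\<in>T. b t * z i t)"
    and bz: "\<And>i t u. i \<in> {1..n} \<Longrightarrow> t \<in> T \<Longrightarrow> u \<in> T \<Longrightarrow> b t * z i u = z i u * b t"
    and zz: "\<And>i j t u. i \<in> {1..n} \<Longrightarrow> j \<in> {1..n} \<Longrightarrow> t \<in> T \<Longrightarrow> u \<in> T \<Longrightarrow> z i t * z j u = z j u * z i t"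
  shows "standard_poly n a = 0"
proof -
  note upt_Suc [simp del]
  let ?xs = "[1..<Suc n]" and ?F = "PiE {1..n} (\<lambda>_. T)" and ?P = "{\<sigma>. \<sigma> permutes {1..n}}"
  have xs: "set ?xs = {1..n}" by auto
  have prod: "prod_list (map (\<lambda>i. a (\<sigma> i)) ?xs)
      = (\<Sum>\<tau>\<in>?F. prod_list (map (\<lambda>i. b (\<tau> i)) ?xs) * prod_list (map (\<lambda>i. z (\<sigma> i) (\<tau> i)) ?xs))"
    if \<sigma>: "\<sigma> permutes {1..n}" for \<sigma>
  proof -
    have \<sigma>i: "\<sigma> i \<in> {1..n}" if "i \<in> {1..n}" for i using \<sigma> that by (meson permutes_in_image)
    have eq: "map (\<lambda>i. a (\<sigma> i)) ?xs = map (\<lambda>i. \<Sum>t\<in>T. b t * z (\<sigma> i) t) ?xs"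
      by (rule map_cong) (auto intro!: a \<sigma>i)
    have "prod_list (map (\<lambda>i. a (\<sigma> i)) ?xs)
        = (\<Sum>\<tau>\<in>?F. prod_list (map (\<lambda>i. b (\<tau> i) * z (\<sigma> i) (\<tau> i)) ?xs))"
      using prod_list_distrib_sum[OF T(1), of ?xs "\<lambda>t i. b t * z (\<sigma> i) t"] unfolding xs eq by simp
    also have "\<dots> = (\<Sum>\<tau>\<in>?F. prod_list (map (\<lambda>i. b (\<tau> i)) ?xs) * prod_list (map (\<lambda>i. z (\<sigma> i) (\<tau> i)) ?xs))"
    proof (intro sum.cong refl prod_list_mult_commuting)
      fix \<tau> i j assume "\<tau> \<in> ?F" "i \<in> set ?xs" "j \<in> set ?xs"
      then show "b (\<tau> i) * z (\<sigma> j) (\<tau> j) = z (\<sigma> j) (\<tau> j) * b (\<tau> i)"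
        unfolding xs by (metis bz \<sigma>i PiE_mem)
    qed
    finally show ?thesis .
  qed
  have pull: "of_int k * (u * v) = u * (of_int k * v)" for k and u v :: 'a
    by (metis mult.assoc mult_of_int_commute)
  have "standard_poly n a = (\<Sum>\<tau>\<in>?F. \<Sum>\<sigma>\<in>?P. of_int (sign \<sigma>) *
      (prod_list (map (\<lambda>i. b (\<tau> i)) ?xs) * prod_list (map (\<lambda>i. z (\<sigma> i) (\<tau> i)) ?xs)))"
    unfolding standard_poly_def sum.swap[of _ ?P ?F] sum_distrib_left[symmetric]
    by (rule sum.cong[OF refl]) (simp only: prod mem_Collect_eq)
  also have "\<dots> = (\<Sum>\<tau>\<in>?F. prod_list (map (\<lambda>i. b (\<tau> i)) ?xs) *
      (\<Sum>\<sigma>\<in>?P. of_int (sign \<sigma>) * prod_list (map (\<lambda>i. z (\<sigma> i) (\<tau> i)) ?xs)))"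
    unfolding sum_distrib_left by (intro sum.cong refl pull)
  also have "\<dots> = 0"
  proof (rule sum.neutral, rule ballI)
    fix \<tau> assume \<tau>: "\<tau> \<in> ?F"
    then have "\<tau> ` {1..n} \<subseteq> T" by auto
    then have "\<not> inj_on \<tau> {1..n}"
      using T card_inj_on_le[of \<tau> "{1..n}" T] by auto
    then have "(\<Sum>\<sigma>\<in>?P. of_int (sign \<sigma>) * prod_list (map (\<lambda>i. z (\<sigma> i) (\<tau> i)) ?xs)) = 0"
      using \<tau> by (intro alternating_sum_eq_0[where T = T] zz) (auto simp: PiE_def)
    then show "prod_list (map (\<lambda>i. b (\<tau> i)) ?xs) *
        (\<Sum>\<sigma>\<in>?P. of_int (sign \<sigma>) * prod_list (map (\<lambda>i. z (\<sigma> i) (\<tau> i)) ?xs)) = 0"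
      by (simp only: mult_zero_right)
  qed
  finally show ?thesis .
qed

section \<open>Wedderburn's little theorem\<close>

lemma power_mult_distrib_commuting:
  fixes x y :: "'a::monoid_mult"
  assumes "x * y = y * x"
  shows "(x * y) ^ n = x ^ n * y ^ n"
proof (induction n)
  case (Suc n)
  have "y * x ^ n = x ^ n * y" using assms by (metis power_commuting_commutes)
  then have "x * y * (x ^ n * y ^ n) = x * x ^ n * (y * y ^ n)"
    by (simp only: mult.assoc) (simp flip: mult.assoc)
  with Suc show ?case by simp
qed simp

section \<open>Elements that commute up to a factor\<close>

lemma quasi_commute_power:
  fixes a b l :: "'a::monoid_mult"
  assumes ba: "b * a = l * (a * b)" and la: "l * a = a * l"
  shows "b * a ^ n = l ^ n * (a ^ n * b)"
proof (induction n)
  case (Suc n)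
  have "b * a ^ Suc n = l * (a * (b * a ^ n))"
    unfolding power_Suc mult.assoc[symmetric] ba by (rule refl)
  also have "\<dots> = l * (a * l ^ n) * (a ^ n * b)" by (simp only: Suc mult.assoc)
  also have "a * l ^ n = l ^ n * a" using la by (rule power_commuting_commutes[symmetric])
  finally show ?case by (simp only: mult.assoc power_Suc)
qed simp

lemma quasi_commute_power_left:
  fixes a b l :: "'a::monoid_mult"
  assumes ba: "b * a = l * (a * b)" and lb: "l * b = b * l"
  shows "b ^ n * a = l ^ n * (a * b ^ n)"
proof (induction n)
  case (Suc n)
  have "b ^ Suc n * a = b * l ^ n * (a * b ^ n)" by (simp only: Suc power_Suc mult.assoc)
  also have "b * l ^ n = l ^ n * b" using lb by (rule power_commuting_commutes[symmetric])
  also have "l ^ n * b * (a * b ^ n) = l ^ n * (b * a) * b ^ n" by (simp only: mult.assoc)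
  also have "\<dots> = l ^ n * l * (a * (b * b ^ n))" by (simp only: ba mult.assoc)
  finally show ?case by (simp only: power_Suc power_Suc2[symmetric])
qed simp

text \<open>To sort the product, the \<open>i\<close>-th factor \<open>c\<close> passes
  \<open>i\<close> factors \<open>b\<close>, and each exchange costs one \<open>m\<close>; hence the
  triangular number. For prime \<open>n\<close> it is divisible by \<open>n\<close> exactly when
  \<open>n\<close> is odd.\<close>

lemma quasi_commute_mult_power:
  fixes b c m :: "'a::monoid_mult"
  assumes bc: "b * c = m * (c * b)" and mb: "m * b = b * m" and mc: "m * c = c * m"
  shows "(b * c) ^ n = m ^ (\<Sum>i\<le>n. i) * (c ^ n * b ^ n)"
proof (induction n)
  case (Suc n)
  have pull: "c ^ n * m ^ k = m ^ k * c ^ n" for k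
    using mc by (metis power_commuting_commutes)
  have "(b * c) ^ Suc n = m ^ (\<Sum>i\<le>n. i) * (c ^ n * (b ^ Suc n * c))"
    by (simp only: Suc power_Suc2 mult.assoc)
  also have "\<dots> = m ^ (\<Sum>i\<le>n. i) * ((c ^ n * m ^ Suc n) * (c * b ^ Suc n))"
    unfolding quasi_commute_power_left[OF bc mb, of "Suc n"] by (simp only: mult.assoc)
  also have "\<dots> = m ^ (\<Sum>i\<le>Suc n. i) * (c ^ Suc n * b ^ Suc n)"
    unfolding pull by (simp only: sum.atMost_Suc power_add power_Suc2[of c] mult.assoc)
  finally show ?case .
qed simp

text \<open>\<open>D\<close> has its own identity \<open>e\<close> because the intended instance is
  a corner \<open>f A f\<close>, whose identity is usually not 1. As \<open>x ^ 0\<close> is 1 and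
  may lie outside \<open>D\<close>, exponents are kept positive and sums of powers start at
  1.\<close>

locale finite_domain =
  fixes D :: "'a::ring_1 set" and e :: 'a
  assumes finite_D: "finite D"
    and e_in [simp]: "e \<in> D" and e_nz [simp]: "e \<noteq> 0"
    and diff_closed [simp]: "x \<in> D \<Longrightarrow> y \<in> D \<Longrightarrow> x - y \<in> D"
    and mult_closed [simp]: "x \<in> D \<Longrightarrow> y \<in> D \<Longrightarrow> x * y \<in> D"
    and e_left [simp]: "x \<in> D \<Longrightarrow> e * x = x"
    and e_right [simp]: "x \<in> D \<Longrightarrow> x * e = x"
    and no_zero_div: "x \<in> D \<Longrightarrow> y \<in> D \<Longrightarrow> x * y = 0 \<Longrightarrow> x = 0 \<or> y = 0"
begin

lemma zero_in [simp]: "0 \<in> D"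
  using diff_closed[OF e_in e_in] by simp

lemma minus_closed [simp]: "x \<in> D \<Longrightarrow> - x \<in> D"
  using diff_closed[of 0 x] by simp

lemma add_closed [simp]: "x \<in> D \<Longrightarrow> y \<in> D \<Longrightarrow> x + y \<in> D"
  using diff_closed[of x "- y"] by simp

lemma sum_closed: "(\<And>i. i \<in> A \<Longrightarrow> f i \<in> D) \<Longrightarrow> sum f A \<in> D"
  by (induction A rule: infinite_finite_induct) auto

lemma power_closed [simp]: "x \<in> D \<Longrightarrow> n > 0 \<Longrightarrow> x ^ n \<in> D"
proof (induction n)
  case (Suc n)
  then show ?case by (cases "n = 0") auto
qed simp

lemma mult_nz: "x \<in> D \<Longrightarrow> y \<in> D \<Longrightarrow> x \<noteq> 0 \<Longrightarrow> y \<noteq> 0 \<Longrightarrow> x * y \<noteq> 0"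
  using no_zero_div by blast

lemma power_nz: "x \<in> D \<Longrightarrow> n > 0 \<Longrightarrow> x \<noteq> 0 \<Longrightarrow> x ^ n \<noteq> 0"
proof (induction n)
  case (Suc n)
  then show ?case by (cases "n = 0") (auto simp: mult_nz)
qed simp

lemma e_power [simp]: "n > 0 \<Longrightarrow> e ^ n = e"
proof (induction n)
  case (Suc n)
  then show ?case by (cases "n = 0") auto
qed simp

lemma e_power_mult: "x \<in> D \<Longrightarrow> e ^ n * x = x"
  by (cases "n = 0") auto

lemma left_cancel: "x \<in> D \<Longrightarrow> x \<noteq> 0 \<Longrightarrow> y \<in> D \<Longrightarrow> z \<in> D \<Longrightarrow> x * y = x * z \<Longrightarrow> y = z"
  using no_zero_div[of x "y - z"] by (simp add: algebra_simps)

lemma right_cancel: "x \<in> D \<Longrightarrow> x \<noteq> 0 \<Longrightarrow> y \<in> D \<Longrightarrow> z \<in> D \<Longrightarrow> y * x = z * x \<Longrightarrow> y = z"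
  using no_zero_div[of "y - z" x] by (simp add: algebra_simps)

lemma exists_power_eq_e:
  assumes "x \<in> D" "x \<noteq> 0"
  shows "\<exists>n>0. x ^ n = e"
proof -
  have "\<not> inj_on (\<lambda>n. x ^ n) {1..}"
  proof
    assume "inj_on (\<lambda>n. x ^ n) {1..}"
    moreover have "(\<lambda>n. x ^ n) ` {1..} \<subseteq> D" using assms by auto
    ultimately show False
      using finite_D finite_imageD[of "\<lambda>n. x ^ n" "{1::nat..}"] infinite_Ici[of "1::nat"] finite_subset
      by blast
  qed
  then obtain i j where "i \<ge> 1" "i < j" "x ^ i = x ^ j"
    by (metis (mono_tags, lifting) atLeast_iff inj_onI linorder_neqE_nat)
  have "x ^ i * x ^ (j - i) = x ^ j" using \<open>i < j\<close> by (simp flip: power_add)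
  also have "\<dots> = x ^ i * e"
    unfolding \<open>x ^ i = x ^ j\<close> by (rule e_right[symmetric]) (use \<open>i < j\<close> assms in auto)
  finally have "x ^ i * x ^ (j - i) = x ^ i * e" .
  moreover have "x ^ i \<in> D" "x ^ i \<noteq> 0" "x ^ (j - i) \<in> D"
    using \<open>i \<ge> 1\<close> \<open>i < j\<close> assms by (auto simp: power_nz)
  ultimately have "x ^ (j - i) = e" using left_cancel e_in by blast
  with \<open>i < j\<close> show ?thesis by (intro exI[of _ "j - i"]) auto
qed

lemma exists_inverse:
  assumes "x \<in> D" "x \<noteq> 0"
  shows "\<exists>k>0. x ^ k * x = e \<and> x * x ^ k = e"
proof -
  obtain n where n: "n > 0" "x ^ n = e" using exists_power_eq_e[OF assms] by blast
  have "x ^ (2 * n) = e" using n by (simp add: power_mult power2_eq_square mult_2 power_add)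
  moreover have "2 * n = Suc (2 * n - 1)" using n by simp
  ultimately have "x ^ Suc (2 * n - 1) = e" by simp
  then have "x * x ^ (2 * n - 1) = e" "x ^ (2 * n - 1) * x = e" by (simp_all add: power_commutes)
  then show ?thesis using n by (intro exI[of _ "2 * n - 1"]) auto
qed

text \<open>Translation by \<open>e\<close> permutes \<open>D\<close>, so adding \<open>e\<close> to
  every element leaves the total unchanged.\<close>

lemma of_nat_card_mult: "of_nat (card D) * e = 0"
proof -
  have "bij_betw (\<lambda>x. x + e) D D"
    by (rule bij_betwI[where g = "\<lambda>x. x - e"]) auto
  then have "(\<Sum>x\<in>D. x + e) = \<Sum>D"
    by (rule sum.reindex_bij_betw[of "\<lambda>x. x + e" D D "\<lambda>x. x"])
  then show ?thesis by (simp add: sum.distrib)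
qed

text \<open>By Lagrange \<open>N\<close> divides the number of nonzero elements, and that number
  times \<open>e\<close> is \<open>- e\<close>. So \<open>N\<close> does not vanish in
  \<open>D\<close>, which makes sums over the powers of \<open>x\<close> usable as averages.\<close>

lemma exists_order:
  assumes x: "x \<in> D" "x \<noteq> 0"
  shows "\<exists>N>0. x ^ N = e \<and> (\<forall>j>0. x ^ j = e \<longrightarrow> N dvd j) \<and> of_nat N * e \<noteq> 0"
proof -
  define G where "G = \<lparr>carrier = D - {0}, monoid.mult = (*), one = e\<rparr>"
  interpret G: group G
  proof (rule groupI)
    fix y assume "y \<in> carrier G"
    then show "\<exists>z\<in>carrier G. z \<otimes>\<^bsub>G\<^esub> y = \<one>\<^bsub>G\<^esub>"
      using exists_inverse[of y] by (auto simp: G_def power_nz intro!: bexI[of _ "y ^ _"])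
  qed (auto simp: G_def mult_nz mult.assoc)
  have pow: "y [^]\<^bsub>G\<^esub> n = y ^ n" if "y \<in> D" "n > 0" for y and n :: nat
    using that(2)
  proof (induction n)
    case (Suc n)
    then show ?case using that(1)
      by (cases "n = 0") (auto simp: G_def power_commutes)
  qed simp
  have xG: "x \<in> carrier G" "finite (carrier G)" using x finite_D by (auto simp: G_def)
  then have N: "G.ord x > 0" using G.ord_ge_1 by fastforce
  have "Coset.order G + 1 = card D"
    using finite_D card_Suc_Diff1[of D 0] by (simp add: Coset.order_def G_def)
  then have "of_nat (Coset.order G) * e + e = 0"
    using of_nat_card_mult by (metis of_nat_add of_nat_1 distrib_right mult_1)
  then have nz: "of_nat (Coset.order G) * e \<noteq> 0" using e_nz by (metis add_0)
  obtain m where "Coset.order G = m * G.ord x"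
    using G.ord_dvd_group_order[OF xG(1)] by (metis dvd_def mult.commute)
  with nz have "of_nat (G.ord x) * e \<noteq> 0" by (auto simp: mult.assoc)
  moreover have "x ^ G.ord x = e" using G.pow_ord_eq_1[OF xG(1)] pow[OF x(1) N] by (simp add: G_def)
  moreover have "G.ord x dvd j" if "j > 0" "x ^ j = e" for j
    using that G.pow_eq_id[OF xG(1), of j] pow[OF x(1), of j] by (simp add: G_def)
  ultimately show ?thesis using N by blast
qed

lemma sum_powers_eq_0:
  assumes "t \<in> D" "t ^ N = e" "t \<noteq> e" "N > 0"
  shows "(\<Sum>i=1..N. t ^ i) = 0"
proof -
  have "(t - e) * (\<Sum>i=1..N. t ^ i) = (\<Sum>i=1..N. t ^ Suc i - t ^ i)"
    unfolding sum_distrib_left using assms by (intro sum.cong) (auto simp: left_diff_distrib)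
  also have "\<dots> = t ^ Suc N - t ^ 1" by (rule sum_Suc_diff) simp
  also have "\<dots> = 0" using assms by simp
  finally have "t - e = 0 \<or> (\<Sum>i=1..N. t ^ i) = 0"
    using assms by (intro no_zero_div) (auto intro: sum_closed)
  with assms show ?thesis by simp
qed

text \<open>A character sum replaces the count of roots of a polynomial. If \<open>y\<close> were no
  power of \<open>l\<close>, each \<open>l ^ i * y\<close> would be a nontrivial \<open>r\<close>-th
  root of unity, so its powers would sum to 0. Summing over \<open>i\<close> and exchanging the sums
  removes all exponents \<open>j < r\<close> and leaves \<open>r\<close> times \<open>e\<close>,
  which is not 0.\<close>

lemma root_of_unity_is_power:
  assumes l: "l \<in> D" "l ^ r = e" "l \<noteq> e" and r: "prime r"
    and y: "y \<in> D" "y ^ r = e" and comm: "l * y = y * l"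
  shows "\<exists>i\<in>{1..r}. y = l ^ i"
proof (rule ccontr)
  assume neg: "\<not> (\<exists>i\<in>{1..r}. y = l ^ i)"
  have r0: "r > 0" using r by (simp add: prime_gt_0_nat)
  have "l \<noteq> 0" using l r0 e_nz by (metis power_0_left neq0_conv)
  then obtain N where N: "N > 0" "l ^ N = e" "\<And>j. j > 0 \<Longrightarrow> l ^ j = e \<Longrightarrow> N dvd j" "of_nat N * e \<noteq> 0"
    using exists_order[OF l(1)] by blast
  have "N \<noteq> 1" using N(2) l(3) by auto
  moreover have "N dvd r" using N(3) l(2) r0 by blast
  ultimately have Nr: "N = r" using r prime_nat_iff by blast
  have ne: "l ^ i * y \<noteq> e" if i: "i \<in> {1..r}" for i
  proof
    assume eq: "l ^ i * y = e"
    show False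
    proof (cases "i = r")
      case True
      then have "y = l ^ r" using eq l y by simp
      with neg r0 show False by auto
    next
      case False
      then have "l ^ (r - i) * (l ^ i * y) = l ^ (r - i)" using eq i l by simp
      moreover have "l ^ (r - i) * (l ^ i * y) = l ^ r * y"
        using i by (simp flip: mult.assoc power_add)
      ultimately have "y = l ^ (r - i)" using l y by simp
      moreover have "r - i \<in> {1..r}" using i False by auto
      ultimately show False using neg by blast
    qed
  qed
  have c: "l ^ i * y = y * l ^ i" for i using comm by (metis power_commuting_commutes)
  have "0 = (\<Sum>i=1..r. \<Sum>j=1..r. (l ^ i * y) ^ j)"
  proof (rule sum.neutral[symmetric], rule ballI)
    fix i assume i: "i \<in> {1..r}"
    have "(l ^ i * y) ^ r = l ^ (r * i) * y ^ r"
      unfolding power_mult_distrib_commuting[OF c] by (metis power_mult mult.commute)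
    also have "\<dots> = e" using y i by (simp add: power_mult l)
    finally show "(\<Sum>j=1..r. (l ^ i * y) ^ j) = 0"
      using ne[OF i] r0 i l y by (intro sum_powers_eq_0) auto
  qed
  also have "\<dots> = (\<Sum>j=1..r. (\<Sum>i=1..r. (l ^ j) ^ i) * y ^ j)"
    unfolding sum_distrib_right power_mult_distrib_commuting[OF c]
    by (subst sum.swap) (simp add: mult.commute flip: power_mult)
  also have "\<dots> = (\<Sum>j\<in>{r}. (\<Sum>i=1..r. (l ^ j) ^ i) * y ^ j)"
  proof (rule sum.mono_neutral_right)
    show "\<forall>j\<in>{1..r} - {r}. (\<Sum>i=1..r. (l ^ j) ^ i) * y ^ j = 0"
    proof
      fix j assume j: "j \<in> {1..r} - {r}"
      then have "l ^ j \<noteq> e" using N(3)[of j] Nr dvd_imp_le[of r j] by auto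
      moreover have "(l ^ j) ^ r = e" using j l
        by (metis DiffD1 atLeastAtMost_iff e_power less_eq_Suc_le One_nat_def mult.commute power_mult)
      ultimately have "(\<Sum>i=1..r. (l ^ j) ^ i) = 0"
        using j l r0 by (intro sum_powers_eq_0) auto
      then show "(\<Sum>i=1..r. (l ^ j) ^ i) * y ^ j = 0" by simp
    qed
  qed (use r0 in auto)
  also have "\<dots> = of_nat N * e"
    using l y Nr by (simp add: mult.assoc)
  finally show False using N(4) by simp
qed

text \<open>The sums \<open>v i\<close> below are the projections to the eigenspaces of right multiplication by \<open>a\<close>
  with eigenvalue \<open>a ^ i\<close> acting from the left.\<close>

lemma exists_conjugate_power:
  assumes a: "a \<in> D" and x: "x \<in> D" and nc: "x * a \<noteq> a * x"
  shows "\<exists>v\<in>D. \<exists>i\<ge>2. v \<noteq> 0 \<and> v * a = a ^ i * v \<and> v * a \<noteq> a * v"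
proof -
  have "a \<noteq> 0" using nc by auto
  then obtain N where N: "N > 0" "a ^ N = e" "\<And>j. j > 0 \<Longrightarrow> a ^ j = e \<Longrightarrow> N dvd j" "of_nat N * e \<noteq> 0"
    using exists_order[OF a] by blast
  have "N \<noteq> 1"
  proof
    assume "N = 1"
    then have "a = e" using N(2) by simp
    then show False using nc x by simp
  qed
  with N have N2: "N \<ge> 2" by simp
  define a' where "a' = a ^ (N - 1)"
  have a': "a' \<in> D" using a N2 by (simp add: a'_def)
  have aa': "a * a' = e" "a' * a = e"
    using N N2 unfolding a'_def by (simp_all flip: power_Suc power_Suc2)
  have aa'n: "a ^ n * a' ^ n = e" "a' ^ n * a ^ n = e" if "n > 0" for n
    using that by (metis aa' e_power power_mult_distrib_commuting)+
  have a'N: "a' ^ N = e" using aa'n[OF N(1)] N a' by simp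
  have a'j: "a' ^ j \<noteq> e" if "0 < j" "j < N" for j
  proof
    assume "a' ^ j = e"
    then have "a ^ j = e" using aa'n[OF that(1)] a that by simp
    then show False using N(3)[of j] dvd_imp_le[of N j] that by simp
  qed
  define h where "h = (\<lambda>i j. a' ^ (i * j) * x * a ^ j)"
  define v where "v = (\<lambda>i. \<Sum>j=1..N. h i j)"
  have hD: "h i j \<in> D" if "i > 0" "j > 0" for i j
    using that a a' x by (simp add: h_def)
  have vD: "v i \<in> D" if "i > 0" for i
    unfolding v_def using that by (intro sum_closed hD) auto
  have va: "v i * a = a ^ i * v i" if i: "i > 0" for i
  proof -
    have "h i j * a = a ^ i * h i (Suc j)" if "j \<in> {1..N}" for j
    proof -
      have "a ^ i * h i (Suc j) = (a ^ i * a' ^ i) * (a' ^ (i * j) * x * (a ^ j * a))"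
        by (simp add: h_def power_add mult.assoc power_commutes)
      also have "\<dots> = a' ^ (i * j) * x * (a ^ j * a)"
        using that i a a' x aa'n by simp
      finally show ?thesis by (simp add: h_def mult.assoc)
    qed
    then have 1: "v i * a = a ^ i * (\<Sum>j=1..N. h i (Suc j))"
      unfolding v_def sum_distrib_left sum_distrib_right by (intro sum.cong) auto
    have 2: "(\<Sum>j=1..N. h i (Suc j)) - v i = h i (Suc N) - h i 1"
      unfolding v_def sum_subtractf[symmetric] by (rule sum_Suc_diff) simp
    have "h i (Suc N) = (a' ^ N) ^ i * a' ^ i * x * (a ^ N * a)"

    proof -
      have "a' ^ (i * Suc N) = a' ^ (N * i + i)" by (simp add: algebra_simps)
      then show ?thesis by (simp only: h_def power_add power_mult[of a' N i] power_Suc2)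
    qed
    also have "\<dots> = h i 1" using i a a' x a'N N by (simp add: h_def)
    finally show ?thesis using 1 2 by simp
  qed
  have "(\<Sum>i=1..N. v i) = (\<Sum>j=1..N. (\<Sum>i=1..N. (a' ^ j) ^ i) * x * a ^ j)"
    unfolding v_def sum_distrib_right h_def
    by (subst sum.swap) (simp add: mult.commute flip: power_mult)
  also have "\<dots> = (\<Sum>j\<in>{N}. (\<Sum>i=1..N. (a' ^ j) ^ i) * x * a ^ j)"
  proof (rule sum.mono_neutral_right)
    show "\<forall>j\<in>{1..N} - {N}. (\<Sum>i=1..N. (a' ^ j) ^ i) * x * a ^ j = 0"
    proof
      fix j assume j: "j \<in> {1..N} - {N}"
      then have "(a' ^ j) ^ N = e"
        using a'N by (metis DiffD1 atLeastAtMost_iff e_power less_eq_Suc_le One_nat_def mult.commute power_mult)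
      with j a' N(1) a'j[of j] have "(\<Sum>i=1..N. (a' ^ j) ^ i) = 0"
        by (intro sum_powers_eq_0) auto
      then show "(\<Sum>i=1..N. (a' ^ j) ^ i) * x * a ^ j = 0" by simp
    qed
  qed (use N in auto)
  also have "\<dots> = of_nat N * x"
    using N a'N x by (simp add: mult.assoc)
  finally have sumv: "(\<Sum>i=1..N. v i) = of_nat N * x" .
  \<comment> \<open>The component \<open>v 1\<close> commutes with \<open>a\<close>. Were it the
    only one, \<open>N\<close> times \<open>x\<close> would commute with \<open>a\<close>, and so
    would \<open>x\<close>, since \<open>N\<close> does not vanish in \<open>D\<close>.\<close>
  have "\<exists>i\<in>{2..N}. v i \<noteq> 0"
  proof (rule ccontr)
    assume "\<not> ?thesis"
    then have "(\<Sum>i=1..N. v i) = (\<Sum>i\<in>{1}. v i)"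
      using N2 by (intro sum.mono_neutral_right) auto
    then have v1: "v 1 = of_nat N * x" using sumv by simp
    have "of_nat N * x * a = a * (of_nat N * x)" using va[of 1] unfolding v1 by simp
    also have "\<dots> = of_nat N * (a * x)" by (simp only: mult.assoc[symmetric] mult_of_nat_commute[of N a])
    finally have "of_nat N * (x * a - a * x) = 0" by (simp add: right_diff_distrib mult.assoc)
    moreover have "of_nat N * e * (x * a - a * x) = of_nat N * (x * a - a * x)"
      using a x by (simp add: mult.assoc)
    ultimately have "of_nat N * e * (x * a - a * x) = 0" by simp
    moreover have "of_nat N * e = (\<Sum>i=1..N. e)" by simp
    moreover have "(\<Sum>i=1..N. e) \<in> D" by (rule sum_closed) simp
    moreover have "x * a - a * x \<noteq> 0" "x * a - a * x \<in> D" using nc a x by auto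
    ultimately show False using N(4) no_zero_div by metis
  qed
  then obtain i where i: "2 \<le> i" "i \<le> N" "v i \<noteq> 0" by auto
  have "v i * a \<noteq> a * v i"
  proof
    assume "v i * a = a * v i"
    then have "a ^ i * v i = a * v i" using va[of i] i by simp
    then have "a ^ i = a" using right_cancel[of "v i" "a ^ i" a] i a vD by auto
    then have "a * a ^ (i - 1) = a * e" using i a by (simp flip: power_Suc)
    then have "a ^ (i - 1) = e" using left_cancel[of a "a ^ (i - 1)" e] i a \<open>a \<noteq> 0\<close> by auto
    then show False using N(3)[of "i - 1"] i by (auto dest: dvd_imp_le)
  qed
  then show ?thesis using i vD[of i] va[of i] by (intro bexI[of _ "v i"] exI[of _ i]) auto
qed

end

text \<open>Models a noncommutative domain whose proper subdomains are commutative: the centralizer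
  of \<open>z\<close> contains the noncommuting \<open>a\<close> and \<open>b\<close>, so it must be
  everything.\<close>

locale minimal_noncommutative_domain = finite_domain +
  fixes u w
  assumes central: "\<And>z a b y. z \<in> D \<Longrightarrow> a \<in> D \<Longrightarrow> b \<in> D \<Longrightarrow> a * b \<noteq> b * a \<Longrightarrow>
      z * a = a * z \<Longrightarrow> z * b = b * z \<Longrightarrow> y \<in> D \<Longrightarrow> z * y = y * z"
    and uw: "u \<in> D" "w \<in> D" "u * w \<noteq> w * u"
begin

definition Z where "Z = {z \<in> D. \<forall>y\<in>D. z * y = y * z}"

lemma Z_in [simp]: "z \<in> Z \<Longrightarrow> z \<in> D"
  unfolding Z_def by blast

lemma Z_comm: "z \<in> Z \<Longrightarrow> y \<in> D \<Longrightarrow> z * y = y * z"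
  unfolding Z_def by blast

lemma in_ZI:
  assumes "z \<in> D" "a \<in> D" "b \<in> D" "a * b \<noteq> b * a" "z * a = a * z" "z * b = b * z"
  shows "z \<in> Z"
  unfolding Z_def using assms(1) central[OF assms] by (intro CollectI conjI ballI)

lemma Z_e [simp]: "e \<in> Z" and Z_zero [simp]: "0 \<in> Z"
  unfolding Z_def by simp_all

lemma Z_mult [simp]:
  assumes "x \<in> Z" "y \<in> Z"
  shows "x * y \<in> Z"
proof -
  have "x * y * v = v * (x * y)" if "v \<in> D" for v
  proof -
    have "x * y * v = x * v * y" using Z_comm[OF assms(2) that] by (simp add: mult.assoc)
    also have "\<dots> = v * (x * y)" using Z_comm[OF assms(1) that] by (simp add: mult.assoc)
    finally show ?thesis .
  qed
  moreover have "x * y \<in> D" using assms by simp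
  ultimately show ?thesis unfolding Z_def by blast
qed

lemma Z_diff [simp]:
  assumes "x \<in> Z" "y \<in> Z"
  shows "x - y \<in> Z"
proof -
  have "(x - y) * v = v * (x - y)" if "v \<in> D" for v
    unfolding left_diff_distrib right_diff_distrib Z_comm[OF assms(1) that] Z_comm[OF assms(2) that]
    by (rule refl)
  moreover have "x - y \<in> D" using assms by simp
  ultimately show ?thesis unfolding Z_def by blast
qed

lemma Z_power [simp]:
  assumes "x \<in> Z" "n > 0"
  shows "x ^ n \<in> Z"
proof -
  have "x ^ n \<in> D" using assms by simp
  moreover have "x ^ n * v = v * x ^ n" if "v \<in> D" for v
    using Z_comm[OF assms(1) that] by (rule power_commuting_commutes)
  ultimately show ?thesis unfolding Z_def by blast
qed

lemma Z_add [simp]: "x \<in> Z \<Longrightarrow> y \<in> Z \<Longrightarrow> x + y \<in> Z"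
  using Z_diff[of x "0 - y"] Z_diff[of 0 y] by simp

lemma Z_inverse: "z \<in> Z \<Longrightarrow> z \<noteq> 0 \<Longrightarrow> \<exists>y\<in>Z. y \<noteq> 0 \<and> y * z = e \<and> z * y = e"
  using exists_inverse[of z] by (metis Z_power Z_in power_nz)

lemma Z_cancel: "z \<in> Z \<Longrightarrow> z \<noteq> 0 \<Longrightarrow> x \<in> D \<Longrightarrow> z * x \<in> Z \<Longrightarrow> x \<in> Z"
proof -
  assume *: "z \<in> Z" "z \<noteq> 0" "x \<in> D" "z * x \<in> Z"
  then obtain y where "y \<in> Z" "y * z = e" using Z_inverse by blast
  then have "y * (z * x) = x" using * by (simp flip: mult.assoc)
  then show ?thesis using * \<open>y \<in> Z\<close> Z_mult by metis
qed

text \<open>Minimality gives two things: \<open>r\<close> is prime, and for a noncentral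
  \<open>v\<close> the power \<open>v ^ (r - 1)\<close> is still noncentral.\<close>

definition r where "r = (LEAST n. n > 0 \<and> (\<exists>y\<in>D - Z. y ^ n \<in> Z))"

lemma r_ex: "\<exists>y\<in>D - Z. y ^ r \<in> Z"
  and r_pos: "r > 0"
  and r_least: "n > 0 \<Longrightarrow> n < r \<Longrightarrow> y \<in> D \<Longrightarrow> y ^ n \<in> Z \<Longrightarrow> y \<in> Z"
proof -
  have "u \<in> D - Z" using uw Z_comm by blast
  moreover then have "u \<noteq> 0" using Z_zero by blast
  ultimately have "\<exists>n. n > 0 \<and> (\<exists>y\<in>D - Z. y ^ n \<in> Z)"
    using exists_power_eq_e[of u] Z_e by (metis DiffD1)
  from LeastI_ex[OF this] show "\<exists>y\<in>D - Z. y ^ r \<in> Z" "r > 0" unfolding r_def by auto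
  show "n > 0 \<Longrightarrow> n < r \<Longrightarrow> y \<in> D \<Longrightarrow> y ^ n \<in> Z \<Longrightarrow> y \<in> Z"
    unfolding r_def by (metis (mono_tags, lifting) not_less_Least DiffI)
qed

lemma prime_r: "prime r"
proof -
  obtain y where y: "y \<in> D" "y \<notin> Z" "y ^ r \<in> Z" using r_ex by blast
  have "r \<noteq> 1" using y(2,3) by (metis power_one_right)
  moreover have "d = 1 \<or> d = r" if "d dvd r" for d
  proof (rule ccontr)
    assume neg: "\<not> (d = 1 \<or> d = r)"
    obtain k where k: "r = d * k" using \<open>d dvd r\<close> by blast
    have pos: "0 < d" "0 < k" using k r_pos by (metis mult_0 mult_0_right neq0_conv)+
    have "d < r" using dvd_imp_le[OF that r_pos] neg by simp
    moreover have "k < r" using k pos neg n_less_m_mult_n[of k d] by simp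
    ultimately have dk: "0 < d" "d < r" "0 < k" "k < r" using pos by blast+
    have "(y ^ d) ^ k \<in> Z" using y(3) by (simp only: power_mult[symmetric] k[symmetric])
    then have "y ^ d \<in> Z" using r_least[OF dk(3,4) power_closed[OF y(1) dk(1)]] by simp
    then show False using r_least[OF dk(1,2) y(1)] y(2) by simp
  qed
  ultimately show ?thesis using r_pos by (auto simp: prime_nat_iff)
qed

lemma r_ge_2: "r \<ge> 2"
  using prime_r by (rule prime_ge_2_nat)

text \<open>Start from noncentral \<open>a\<close> with \<open>a ^ r\<close> central and from
  \<open>v\<close> with \<open>v * a = a ^ i * v\<close>. If \<open>r\<close> divided
  \<open>i\<close>, then \<open>a ^ i\<close> would be central and equal to \<open>a\<close>. So
  Fermat gives \<open>i ^ (r - 1) = 1 + r * k\<close>, and \<open>b = v ^ (r - 1)\<close> conjugates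
  \<open>a\<close> into \<open>a\<close> times the central element \<open>l = (a ^ r) ^ k\<close>.
  As \<open>a ^ r\<close> is central, moving \<open>b\<close> past it shows
  \<open>l ^ r = e\<close>; then \<open>b ^ r\<close> commutes with the noncommuting pair
  \<open>a\<close>, \<open>b\<close> and is central.\<close>

lemma exists_quasi_commuting:
  "\<exists>a\<in>D. \<exists>b\<in>D. \<exists>l\<in>Z. a ^ r \<in> Z \<and> b ^ r \<in> Z \<and> b * a = l * (a * b) \<and> b * a \<noteq> a * b \<and> l \<noteq> e \<and> l ^ r = e"
proof -
  obtain a where a: "a \<in> D" "a \<notin> Z" "a ^ r \<in> Z" using r_ex by blast
  obtain x where x: "x \<in> D" "x * a \<noteq> a * x" 
  proof -
    have "\<exists>x\<in>D. a * x \<noteq> x * a" using a(1,2) unfolding Z_def by blast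
    then show ?thesis using that by metis
  qed
  obtain v i where v: "v \<in> D" "i \<ge> 2" "v \<noteq> 0" "v * a = a ^ i * v" "v * a \<noteq> a * v"
    using exists_conjugate_power[OF a(1) x] by blast
  have a0: "a \<noteq> 0" using a(2) Z_zero by blast
  have "\<not> r dvd i"
  proof
    assume "r dvd i"
    then obtain k where k: "i = r * k" by blast
    then have "a ^ i \<in> Z" using a v(2) by (cases "k = 0") (auto simp: power_mult)
    then have "v * a = v * a ^ i" using v Z_comm by simp
    then have "a = a ^ i" using left_cancel[of v a "a ^ i"] v a by simp
    with \<open>a ^ i \<in> Z\<close> a show False by simp
  qed
  then have "[i ^ (r - 1) = 1] (mod r)" using fermat_theorem[OF prime_r] by blast
  then obtain k where "i ^ (r - 1) - 1 = r * k" using cong_to_1_nat by blast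
  moreover have i1: "i ^ (r - 1) > 1" using v(2) r_ge_2 by (intro one_less_power) auto
  ultimately have k: "i ^ (r - 1) = Suc (r * k)" by simp
  with i1 have k0: "k > 0" by (cases k) auto
  define b l where "b = v ^ (r - 1)" and "l = (a ^ r) ^ k"
  have vn: "v ^ n * a = a ^ (i ^ n) * v ^ n" for n
  proof (induction n)
    case (Suc n)
    have vj: "v * a ^ j = a ^ (i * j) * v" for j
    proof (induction j)
      case (Suc j)
      have "v * a ^ Suc j = v * a * a ^ j" by (simp add: mult.assoc)
      also have "\<dots> = a ^ i * (v * a ^ j)" by (simp add: v(4) mult.assoc)
      finally show ?case by (simp add: Suc power_add mult.assoc)
    qed simp
    have "v ^ Suc n * a = v * a ^ (i ^ n) * v ^ n" using Suc by (simp add: mult.assoc)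
    then show ?case unfolding vj by (simp add: mult.assoc)
  qed simp
  have r1: "r - 1 > 0" "r - 1 < r" using r_ge_2 by auto
  have b: "b \<in> D" using v r1 by (simp add: b_def)
  have l: "l \<in> Z" using a k0 by (simp add: l_def)
  have ba: "b * a = l * (a * b)"
    using vn[of "r - 1"] unfolding k b_def l_def power_Suc2 power_mult by (simp only: mult.assoc)
  have vZ: "v \<notin> Z" using v Z_comm a by blast
  then have bZ: "b \<notin> Z" using r_least[of "r - 1" v] r1 v by (auto simp: b_def)
  have nc: "b * a \<noteq> a * b"
  proof
    assume "b * a = a * b"
    then have "b \<in> Z" using in_ZI[OF b v(1) a(1) v(5)] by (simp add: b_def power_commutes)
    with bZ show False by simp
  qed
  have le: "l \<noteq> e"
  proof
    assume "l = e"
    then have "b * a = a * b" unfolding ba using a b by simp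
    with nc show False by simp
  qed
  note bn = quasi_commute_power[OF ba Z_comm[OF l a(1)]]
  have arb: "a ^ r * b \<in> D" "a ^ r * b \<noteq> 0" "l ^ r \<in> D"
  proof -
    have "b \<noteq> 0" using bZ Z_zero by blast
    then show "a ^ r * b \<noteq> 0" using mult_nz[OF _ b power_nz[OF a(1) r_pos a0]] a(1) r_pos by simp
  qed (use a b l r_pos in auto)
  have "l ^ r * (a ^ r * b) = b * a ^ r" by (rule bn[symmetric])
  also have "\<dots> = a ^ r * b" by (rule Z_comm[OF a(3) b, symmetric])
  also have "\<dots> = e * (a ^ r * b)" by (rule e_left[OF arb(1), symmetric])
  finally have lr: "l ^ r = e" using right_cancel arb e_in by blast
  note bna = quasi_commute_power_left[OF ba Z_comm[OF l b]]
  have "a * b ^ r \<in> D" using a b r_pos by simp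
  then have bra: "b ^ r * a = a * b ^ r" unfolding bna[of r] lr by simp
  have "b ^ r \<in> D" "a * b \<noteq> b * a" "b ^ r * b = b * b ^ r"
    using b nc r_pos by (auto simp: power_commutes)
  then have "b ^ r \<in> Z" using in_ZI[OF _ a(1) b _ bra] by blast
  with a b l ba nc le lr show ?thesis by blast
qed

text \<open>Dividing \<open>y\<close> by the central \<open>z\<close> gives an \<open>r\<close>-th
  root of unity, hence a power of \<open>l\<close>. Consequently no noncentral element shares its
  \<open>r\<close>-th power with a nonzero central one.\<close>

lemma root_of_power:
  assumes l: "l \<in> Z" "l ^ r = e" "l \<noteq> e" and y: "y \<in> D" and z: "z \<in> Z" "z \<noteq> 0" "y ^ r = z ^ r"
  shows "\<exists>i\<in>{1..r}. y = z * l ^ i"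
proof -
  obtain x where x: "x \<in> Z" "x * z = e" "z * x = e" using Z_inverse z by blast
  have "(x * y) ^ r = x ^ r * z ^ r"
    using power_mult_distrib_commuting[OF Z_comm[OF x(1) y], of r] z(3) by simp
  also have "\<dots> = (x * z) ^ r"
    by (rule power_mult_distrib_commuting[symmetric]) (simp only: x)
  also have "\<dots> = e" unfolding x using r_pos by simp
  finally have xy: "(x * y) ^ r = e" .
  have xyD: "x * y \<in> D" using x y by simp
  obtain i where i: "i \<in> {1..r}" "x * y = l ^ i"
    using root_of_unity_is_power[OF Z_in[OF l(1)] l(2,3) prime_r xyD xy Z_comm[OF l(1) xyD]] by blast
  have "z * (x * y) = y" unfolding mult.assoc[symmetric] x using y by simp
  with i show ?thesis by auto
qed

lemma root_in_Z:
  assumes "l \<in> Z" "l ^ r = e" "l \<noteq> e" "y \<in> D" "z \<in> Z" "z \<noteq> 0" "y ^ r = z ^ r"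
  shows "y \<in> Z"
proof -
  obtain i where "i \<in> {1..r}" "y = z * l ^ i" using root_of_power[OF assms] by blast
  then show ?thesis using assms by simp
qed

lemma Z_mult_mult:
  assumes "z' \<in> Z" "x \<in> D"
  shows "(z * x) * (z' * y) = (z * z') * (x * y)"
proof -
  have "(z * x) * (z' * y) = z * (x * z') * y" by (simp only: mult.assoc)
  also have "x * z' = z' * x" using Z_comm[OF assms] by simp
  finally show ?thesis by (simp only: mult.assoc)
qed

lemma finite_Z: "finite Z"
  by (rule finite_subset[OF _ finite_D]) (simp add: subset_iff)

lemma eq_or_eq_minus:
  assumes "x \<in> D" "y \<in> D" "x * y = y * x" "x * x = y * y"
  shows "x = y \<or> x = - y"
proof -
  have "(x - y) * (x + y) = x * x - y * y + (x * y - y * x)" by (simp add: algebra_simps)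
  also have "\<dots> = 0" using assms by simp
  finally have "x - y = 0 \<or> x + y = 0" using assms by (intro no_zero_div) auto
  then show ?thesis by (auto simp: eq_neg_iff_add_eq_0)
qed

text \<open>For \<open>r = 2\<close> the triangular exponent 3 is not a multiple of
  \<open>r\<close>, so a product of powers of \<open>a\<close> and \<open>b\<close> does not help.
  Instead a linear combination \<open>t = x * a + y * b\<close> with central coefficients is found
  whose square is \<open>e\<close>, since the mixed terms cancel by
  \<open>b * a = - (a * b)\<close>. Then \<open>t\<close> is \<open>e\<close> or \<open>- e\<close>,
  hence central, and this forces \<open>y = 0\<close> and \<open>x = 0\<close>.\<close>

lemma r_eq_2_impossible:
  assumes "r = 2"
  shows False
proof -
  obtain a b l where ab: "a \<in> D" "b \<in> D" "a ^ r \<in> Z" "b ^ r \<in> Z"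
    and l: "l \<in> Z" "b * a = l * (a * b)" "l \<noteq> e" "l ^ r = e" and nc: "b * a \<noteq> a * b"
    using exists_quasi_commuting by blast
  have aZ: "a * a \<in> Z" and bZ: "b * b \<in> Z" and ll: "l * l = e * e"
    using ab l(4) assms by (simp_all add: power2_eq_square)
  have "l = - e" using eq_or_eq_minus[of l e] ll l by simp
  then have ba: "b * a = - (a * b)" using l(2) ab by simp
  have ne: "- e \<noteq> e" using l \<open>l = - e\<close> by simp
  have a0: "a \<noteq> 0" and b0: "b \<noteq> 0" using nc by auto
  have anZ: "a \<notin> Z" using nc Z_comm[OF _ ab(2), of a] by metis
  define S where "S = (\<lambda>z. z * z) ` Z"
  define s where "s w = (SOME z. z \<in> Z \<and> z * z = w)" for w
  have s: "s w \<in> Z \<and> s w * s w = w" if "w \<in> S" for w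
    unfolding s_def by (rule someI_ex) (use that in \<open>auto simp: S_def\<close>)
  have SZ: "S \<subseteq> Z" and fS: "finite S" and S0: "0 \<in> S"
    using finite_Z Z_zero by (auto simp: S_def image_iff intro!: bexI[of _ 0])
  \<comment> \<open>Every square has at most two roots and 0 has only one, so more than half of
    \<open>Z\<close> are squares. Therefore the sets \<open>X\<close> and \<open>Y\<close> below,
    each as large as \<open>S\<close>, must meet.\<close>
  have "Z \<subseteq> s ` S \<union> (\<lambda>w. - s w) ` (S - {0})"
  proof
    fix z assume z: "z \<in> Z"
    then have w: "z * z \<in> S" by (simp add: S_def)
    have "z = s (z * z) \<or> z = - s (z * z)"
      using s[OF w] z Z_comm[of z "s (z * z)"] by (intro eq_or_eq_minus) auto
    moreover have "z = s (z * z)" if "z * z = 0"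
    proof -
      have "z = 0" using no_zero_div[of z z] z that by auto
      moreover have "s 0 = 0" using s[OF S0] no_zero_div[of "s 0" "s 0"] by auto
      ultimately show ?thesis by simp
    qed
    ultimately show "z \<in> s ` S \<union> (\<lambda>w. - s w) ` (S - {0})" using w by blast
  qed
  then have "card Z \<le> card (s ` S \<union> (\<lambda>w. - s w) ` (S - {0}))"
    using fS by (intro card_mono) auto
  also have "\<dots> \<le> card (s ` S) + card ((\<lambda>w. - s w) ` (S - {0}))" by (rule card_Un_le)
  also have "\<dots> \<le> card S + card (S - {0})"
    using fS by (intro add_mono card_image_le) auto
  also have "\<dots> < 2 * card S" using fS S0 card_Diff1_less[of S 0] by simp
  finally have less: "card Z < 2 * card S" .
  define X where "X = (\<lambda>w. (a * a) * w) ` S"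
  define Y where "Y = (\<lambda>w. e - (b * b) * w) ` S"
  have "inj_on (\<lambda>w. (a * a) * w) S"
    using SZ ab a0 left_cancel[of "a * a"] mult_nz[of a a] by (intro inj_onI) (meson Z_in subsetD mult_closed)
  then have cX: "card X = card S" unfolding X_def by (rule card_image)
  have "inj_on (\<lambda>w. e - (b * b) * w) S"
    using SZ ab b0 left_cancel[of "b * b"] mult_nz[of b b]
    by (intro inj_onI) (metis Z_in subsetD mult_closed diff_left_imp_eq)
  then have cY: "card Y = card S" unfolding Y_def by (rule card_image)
  have XY: "X \<subseteq> Z" "Y \<subseteq> Z" using SZ aZ bZ by (auto simp: X_def Y_def)
  have "X \<inter> Y \<noteq> {}"
  proof
    assume "X \<inter> Y = {}"
    then have "card (X \<union> Y) = 2 * card S"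
      using cX cY fS by (subst card_Un_disjoint) (auto simp: X_def Y_def)
    moreover have "card (X \<union> Y) \<le> card Z" using XY finite_Z by (intro card_mono) auto
    ultimately show False using less by simp
  qed
  then obtain x y where xy: "x \<in> Z" "y \<in> Z" "(a * a) * (x * x) = e - (b * b) * (y * y)"
    by (auto simp: X_def Y_def S_def)
  define t where "t = x * a + y * b"
  have t: "t \<in> D" using xy ab by (simp add: t_def)
  have "t * t = x * a * (x * a) + x * a * (y * b) + (y * b * (x * a) + y * b * (y * b))"
    by (simp only: t_def distrib_left distrib_right add.assoc add.left_commute)
  also have "\<dots> = x * x * (a * a) + x * y * (a * b) + (y * x * (b * a) + y * y * (b * b))"
    unfolding Z_mult_mult[OF xy(1) ab(1)] Z_mult_mult[OF xy(2) ab(1)]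
      Z_mult_mult[OF xy(1) ab(2)] Z_mult_mult[OF xy(2) ab(2)] by (rule refl)
  also have "\<dots> = a * a * (x * x) + b * b * (y * y)"
    using Z_comm[of "x * x" "a * a"] Z_comm[of "y * y" "b * b"] Z_comm[OF xy(1), of y] xy ab
    by (simp add: ba)
  also have "\<dots> = e * e" unfolding xy(3) by simp
  finally have "t * t = e * e" .
  then have "t = e \<or> t = - e" using t by (intro eq_or_eq_minus) auto
  moreover have "- e \<in> Z" using Z_diff[of 0 e] by simp
  ultimately have tZ: "t \<in> Z" by auto
  have "x * a * a + y * b * a = a * (x * a) + a * (y * b)"
    using Z_comm[OF tZ ab(1)] by (simp only: t_def distrib_left distrib_right)
  also have "\<dots> = x * a * a + y * (a * b)"
    unfolding mult.assoc[symmetric] Z_comm[OF xy(1) ab(1), symmetric] Z_comm[OF xy(2) ab(1), symmetric]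
    by (rule refl)
  finally have "y * (b * a) = y * (a * b)" by (simp add: mult.assoc)
  then have "y = 0" using left_cancel[of y "b * a" "a * b"] nc xy ab by auto
  then have tx: "t = x * a" by (simp add: t_def)
  then have "x = 0" using Z_cancel[of x a] tZ anZ ab xy by auto
  then show False using \<open>t * t = e * e\<close> tx by simp
qed

text \<open>No power \<open>\<alpha> ^ k\<close> with \<open>0 < k < r\<close> is an
  \<open>r\<close>-th power in the group \<open>Z'\<close>, so the \<open>r\<close> cosets of the
  group \<open>I\<close> of \<open>r\<close>-th powers given by \<open>\<alpha> ^ m\<close> are
  distinct. As each element of \<open>I\<close> has at most \<open>r\<close> roots, these cosets
  fill \<open>Z'\<close>. So \<open>b ^ r\<close> lies in one of them, and multiplying
  \<open>b\<close> by a power of \<open>a\<close> gives an element whose \<open>r\<close>-th power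
  is that of a central one. This element is then central, though it commutes with \<open>a\<close>
  only up to \<open>l\<close>.\<close>

lemma r_neq_2_impossible:
  assumes "r \<noteq> 2"
  shows False
proof -
  obtain a b l where ab: "a \<in> D" "b \<in> D" "a ^ r \<in> Z" "b ^ r \<in> Z"
    and l: "l \<in> Z" "b * a = l * (a * b)" "l \<noteq> e" "l ^ r = e" and nc: "b * a \<noteq> a * b"
    using exists_quasi_commuting by blast
  have a0: "a \<noteq> 0" and b0: "b \<noteq> 0" using nc by auto
  have anZ: "a \<notin> Z" using nc Z_comm[OF _ ab(2), of a] by metis
  define \<alpha> where "\<alpha> = a ^ r"
  have \<alpha>: "\<alpha> \<in> Z" "\<alpha> \<noteq> 0" using ab a0 r_pos by (auto simp: \<alpha>_def power_nz)
  have not_power: "\<alpha> ^ k \<noteq> z ^ r" if "0 < k" "k < r" "z \<in> Z" "z \<noteq> 0" for k z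
  proof
    assume "\<alpha> ^ k = z ^ r"
    then have "(a ^ k) ^ r = z ^ r" by (simp add: \<alpha>_def mult.commute flip: power_mult)
    then have "a ^ k \<in> Z"
      using root_in_Z[OF l(1,4,3) power_closed[OF ab(1) that(1)] that(3,4)] by blast
    then show False using r_least[OF that(1,2) ab(1)] anZ by blast
  qed
  define Z' where "Z' = Z - {0}"
  define I where "I = (\<lambda>z. z ^ r) ` Z'"
  have fin: "finite Z'" "finite I" using finite_Z by (auto simp: Z'_def I_def)
  define s where "s w = (SOME z. z \<in> Z' \<and> z ^ r = w)" for w
  have s: "s w \<in> Z' \<and> s w ^ r = w" if "w \<in> I" for w
    unfolding s_def by (rule someI_ex) (use that in \<open>auto simp: I_def\<close>)
  have "Z' \<subseteq> (\<lambda>(w, i). s w * l ^ i) ` (I \<times> {1..r})"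
  proof
    fix z assume z: "z \<in> Z'"
    then have w: "z ^ r \<in> I" by (simp add: I_def)
    then obtain i where "i \<in> {1..r}" "z = s (z ^ r) * l ^ i"
      using root_of_power[OF l(1,4,3), of z "s (z ^ r)"] s[OF w] z by (auto simp: Z'_def)
    with w show "z \<in> (\<lambda>(w, i). s w * l ^ i) ` (I \<times> {1..r})"
      by (intro image_eqI[of _ _ "(z ^ r, i)"]) simp_all
  qed
  then have "card Z' \<le> card (I \<times> {1..r})" using fin by (intro surj_card_le) auto
  then have card_le: "card Z' \<le> card I * r" by (simp add: card_cartesian_product)
  define \<Phi> where "\<Phi> = (\<lambda>(w, m). w * \<alpha> ^ m)"
  have \<Phi>Z: "\<Phi> ` (I \<times> {1..r}) \<subseteq> Z'"
    using \<alpha> r_pos by (auto simp: \<Phi>_def I_def Z'_def mult_nz power_nz)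
  have inj_aux: "m' \<le> m" if w: "w \<in> I" "w' \<in> I" "w * \<alpha> ^ m = w' * \<alpha> ^ m'" and m: "1 \<le> m" "m' \<le> r"
    for w w' m m'
  proof (rule ccontr)
    assume "\<not> m' \<le> m"
    then have k: "0 < m' - m" "m' - m < r" "m' = (m' - m) + m" using m by auto
    obtain z z' where z: "z \<in> Z'" "w = z ^ r" "z' \<in> Z'" "w' = z' ^ r" using w by (auto simp: I_def)
    then obtain x where x: "x \<in> Z" "x * z' = e" "x \<noteq> 0" using Z_inverse by (auto simp: Z'_def)
    have wD: "w \<in> D" "w' \<in> D" using z r_pos by (auto simp: Z'_def)
    have \<alpha>D: "\<alpha> ^ m \<in> D" "\<alpha> ^ m \<noteq> 0" "w' * \<alpha> ^ (m' - m) \<in> D"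
      using \<alpha> m(1) k(1) wD by (auto simp: power_nz)
    have "w * \<alpha> ^ m = w' * \<alpha> ^ (m' - m) * \<alpha> ^ m"
      unfolding w(3) mult.assoc power_add[symmetric] k(3)[symmetric] by (rule refl)
    then have "w = w' * \<alpha> ^ (m' - m)"
      using right_cancel[OF \<alpha>D(1,2) wD(1) \<alpha>D(3)] by blast
    then have "x ^ r * w = (x ^ r * w') * \<alpha> ^ (m' - m)" by (simp add: mult.assoc)
    moreover have "x ^ r * w' = (x * z') ^ r"
      unfolding z using x z Z_comm[of x z'] by (intro power_mult_distrib_commuting[symmetric]) (auto simp: Z'_def)
    moreover have "x ^ r * w = (x * z) ^ r"
      unfolding z using x z Z_comm[of x z] by (intro power_mult_distrib_commuting[symmetric]) (auto simp: Z'_def)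
    ultimately have "(x * z) ^ r = (x * z') ^ r * \<alpha> ^ (m' - m)" by simp
    also have "\<dots> = \<alpha> ^ (m' - m)" unfolding x(2) using \<alpha>(1) k(1) r_pos by simp
    finally have "\<alpha> ^ (m' - m) = (x * z) ^ r" by simp
    then show False using not_power[OF k(1,2), of "x * z"] x z by (auto simp: Z'_def mult_nz)
  qed
  have "inj_on \<Phi> (I \<times> {1..r})"
  proof (rule inj_onI, clarify)
    fix w m w' m'
    assume *: "w \<in> I" "w' \<in> I" "m \<in> {1..r}" "m' \<in> {1..r}" "\<Phi> (w, m) = \<Phi> (w', m')"
    then have eq: "w * \<alpha> ^ m = w' * \<alpha> ^ m'" by (simp add: \<Phi>_def)
    have mm: "m = m'"
      using inj_aux[OF *(1,2) eq] inj_aux[OF *(2,1) eq[symmetric]] *(3,4) by (intro order.antisym) auto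
    have "w \<in> D" "w' \<in> D" using * r_pos by (auto simp: I_def Z'_def)
    then have "w = w'" using right_cancel[of "\<alpha> ^ m" w w'] eq \<alpha> *(3) mm by (simp add: power_nz)
    with mm show "w = w' \<and> m = m'" by simp
  qed
  then have "card (\<Phi> ` (I \<times> {1..r})) = card I * r"
    by (simp add: card_image card_cartesian_product)
  then have "\<Phi> ` (I \<times> {1..r}) = Z'" using card_seteq[OF fin(1) \<Phi>Z] card_le by simp
  moreover have "b ^ r \<in> Z'" using ab b0 r_pos by (simp add: Z'_def power_nz)
  ultimately have "b ^ r \<in> \<Phi> ` (I \<times> {1..r})" by simp
  then obtain w m where m: "m \<in> {1..r}" and "w \<in> I" "b ^ r = \<Phi> (w, m)" by blast
  then obtain z where z: "z \<in> Z" "z \<noteq> 0" and \<beta>: "b ^ r = z ^ r * \<alpha> ^ m"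
    by (auto simp: \<Phi>_def I_def Z'_def)
  \<comment> \<open>The exponent \<open>r - m\<close> completes \<open>\<alpha> ^ m\<close> to
    \<open>\<alpha> ^ r\<close>, which makes \<open>c ^ r * b ^ r\<close> an \<open>r\<close>-th
    power of a central element.\<close>
  define k c where "k = r - m" and "c = a ^ k"
  have lk: "l ^ k * x = x * l ^ k" if "x \<in> D" for x
    using Z_comm[OF l(1) that] by (rule power_commuting_commutes)
  have lc: "l ^ k * c = c * l ^ k" unfolding c_def
    by (rule power_commuting_commutes, rule power_commuting_commutes[symmetric])
      (rule Z_comm[OF l(1) ab(1), symmetric])
  have bc: "b * c = l ^ k * (c * b)" unfolding c_def
    by (rule quasi_commute_power[OF l(2) Z_comm[OF l(1) ab(1)]])
  have bcD: "b * c \<in> D" using ab m by (cases "k = 0") (auto simp: c_def)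
  have cbr: "c ^ r * b ^ r = (z * \<alpha>) ^ r"
  proof -
    have "c ^ r * b ^ r = \<alpha> ^ k * (z ^ r * \<alpha> ^ m)"
      unfolding \<beta> by (simp add: c_def \<alpha>_def mult.commute flip: power_mult)
    also have "\<dots> = z ^ r * (\<alpha> ^ k * \<alpha> ^ m)"
    proof -
      have "\<alpha> ^ k * z ^ r = z ^ r * \<alpha> ^ k"
        using Z_comm[OF \<alpha>(1), of "z ^ r"] z r_pos by (intro power_commuting_commutes) auto
      then show ?thesis by (simp only: mult.assoc[symmetric])
    qed
    also have "\<alpha> ^ k * \<alpha> ^ m = \<alpha> ^ r" using m by (simp add: k_def flip: power_add)
    also have "z ^ r * \<alpha> ^ r = (z * \<alpha>) ^ r"
      using Z_comm[OF z(1), of \<alpha>] \<alpha> by (intro power_mult_distrib_commuting[symmetric]) auto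
    finally show ?thesis .
  qed
  \<comment> \<open>For odd \<open>r\<close> the triangular number of \<open>r\<close> is a multiple
    of \<open>r\<close>, so the factor from sorting \<open>(b * c) ^ r\<close> is a power of
    \<open>l ^ r = e\<close>.\<close>
  have "odd r" using prime_odd_nat[OF prime_r] r_ge_2 assms by simp
  then obtain q where q: "Suc r = 2 * q" by (metis even_Suc evenE)
  have "(\<Sum>i\<le>r. i) = r * q" using gauss_sum_nat[of r] q by (simp add: atLeast0AtMost)
  moreover have "k * (r * q) = r * (k * q)" by simp
  ultimately have "(l ^ k) ^ (\<Sum>i\<le>r. i) = (l ^ r) ^ (k * q)"
    by (simp only: power_mult[symmetric])
  then have "(b * c) ^ r = (z * \<alpha>) ^ r"
    unfolding quasi_commute_mult_power[OF bc lk[OF ab(2)] lc] cbr l(4)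
    using z \<alpha> r_pos by (simp add: e_power_mult)
  then have "b * c \<in> Z"
    using root_in_Z[OF l(1,4,3) bcD, of "z * \<alpha>"] z \<alpha> by (auto simp: mult_nz)
  then have "b * c * a = a * (b * c)" using Z_comm ab by blast
  moreover have "b * c * a = l * (a * (b * c))"
  proof -
    have "b * c * a = b * a * c" by (simp add: c_def mult.assoc power_commutes)
    then show ?thesis by (simp only: l(2) mult.assoc)
  qed
  ultimately have "l * (a * (b * c)) = e * (a * (b * c))" using ab bcD by simp
  moreover have "b * c \<noteq> 0"
    using ab a0 b0 by (cases "k = 0") (auto simp: c_def mult_nz power_nz)
  ultimately show False using right_cancel[of "a * (b * c)" l e] ab bcD l a0 mult_nz by auto
qed

end

theorem finite_domain_commute:
  fixes D :: "'a::ring_1 set"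
  assumes "finite_domain D e" "x \<in> D" "y \<in> D"
  shows "x * y = y * x"
  using assms
proof (induction "card D" arbitrary: D x y rule: less_induct)
  case less
  interpret finite_domain D e by fact
  show ?case
  proof (rule ccontr)
    assume xy: "x * y \<noteq> y * x"
    interpret minimal_noncommutative_domain D e x y
    proof
      fix z a b v
      assume z: "z \<in> D" and a: "a \<in> D" "b \<in> D" "a * b \<noteq> b * a" "z * a = a * z" "z * b = b * z"
        and v: "v \<in> D"
      \<comment> \<open>If this centralizer were proper, the induction hypothesis would make it
        commutative, although it contains \<open>a\<close> and \<open>b\<close>.\<close>
      define C where "C = {t \<in> D. z * t = t * z}"
      have C: "finite_domain C e"
      proof
        fix s t assume st: "s \<in> C" "t \<in> C"
        have "z * (s * t) = s * z * t" using st by (simp add: C_def flip: mult.assoc)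
        also have "\<dots> = s * t * z" using st by (simp add: C_def mult.assoc)
        finally show "s * t \<in> C" using st by (simp add: C_def)
        show "s * t = 0 \<Longrightarrow> s = 0 \<or> t = 0" using st no_zero_div by (simp add: C_def)
      qed (use finite_D z in \<open>auto simp: C_def algebra_simps\<close>)
      have "a \<in> C" "b \<in> C" using a by (auto simp: C_def)
      then have "\<not> card C < card D" using less.hyps[OF _ C] a(3) by blast
      then have "C = D" using finite_D by (intro card_seteq) (auto simp: C_def)
      then show "z * v = v * z" using v by (auto simp: C_def)
    qed (use less.prems xy in auto)
    show False using r_eq_2_impossible r_neq_2_impossible by blast
  qed
qed

section \<open>Finite regular rings\<close>

text \<open>The \<open>v i\<close> are independent vectors in the space \<open>A f\<close> over the
  corner at \<open>f\<close>, and the \<open>w i\<close> in \<open>f A\<close> are coordinate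
  functionals for them. The products \<open>v i * w j\<close> are then matrix units.\<close>

definition dual_system :: "nat \<Rightarrow> 'a::ring_1 \<Rightarrow> (nat \<Rightarrow> 'a) \<Rightarrow> (nat \<Rightarrow> 'a) \<Rightarrow> bool"
  where "dual_system n f v w \<longleftrightarrow> (\<forall>i<n. v i * f = v i \<and> f * w i = w i) \<and>
    (\<forall>i<n. \<forall>j<n. w i * v j = (if i = j then f else 0))"

lemma dual_systemD:
  assumes "dual_system n f v w"
  shows "i < n \<Longrightarrow> v i * f = v i" "i < n \<Longrightarrow> f * w i = w i"
    "i < n \<Longrightarrow> j < n \<Longrightarrow> w i * v j = (if i = j then f else 0)"
  using assms by (simp_all add: dual_system_def)

text \<open>For a dual system of size \<open>2 d + 1\<close>, the square-zero elements
  \<open>\<Sum> v\<^sub>2\<^sub>i w\<^sub>2\<^sub>i\<^sub>+\<^sub>1\<close> and \<open>\<Sum> v\<^sub>2\<^sub>i\<^sub>+\<^sub>1 w\<^sub>2\<^sub>i\<^sub>+\<^sub>2\<close> have a product that behaves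
  like a nilpotent Jordan block of size \<open>d + 1\<close>.\<close>

lemma dual_system_size_le:
  fixes scale :: "'k::field \<Rightarrow> 'a::ring_1 \<Rightarrow> 'a" and f :: 'a
  assumes P1: "property_P1 scale g" and g: "g \<noteq> 0"
    and scale: "\<And>c x y. x * scale c y = scale c (x * y)" "\<And>c x y. scale c x * y = scale c (x * y)"
      "\<And>c x. scale c x = 0 \<longleftrightarrow> c = 0 \<or> x = 0"
    and dual: "dual_system n f v w" and f: "f \<noteq> 0"
  shows "n \<le> 2 * Polynomial.degree g"
proof (rule ccontr)
  define d where "d = Polynomial.degree g"
  assume "\<not> n \<le> 2 * Polynomial.degree g"
  then have n: "2 * d < n" by (simp add: d_def)
  note D = dual_systemD[OF dual]
  define a where "a = (\<Sum>i<d. v (2 * i) * w (2 * i + 1))"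
  define b where "b = (\<Sum>i<d. v (2 * i + 1) * w (2 * i + 2))"
  have wa: "w k * a = (if even k then w (k + 1) else 0)" if "k < 2 * d" for k
  proof -
    have "w k * a = (\<Sum>i<d. (w k * v (2 * i)) * w (2 * i + 1))"
      by (simp add: a_def sum_distrib_left mult.assoc)
    also have "\<dots> = (\<Sum>i<d. if i = k div 2 then (if even k then w (k + 1) else 0) else 0)"
      using n that D by (intro sum.cong) (auto elim!: evenE oddE)
    also have "\<dots> = (if even k then w (k + 1) else 0)"
      using that by (subst sum.delta) auto
    finally show ?thesis .
  qed
  have wb: "w k * b = (if odd k then w (k + 1) else 0)" if "k \<le> 2 * d" for k
  proof -
    have "w k * b = (\<Sum>i<d. (w k * v (2 * i + 1)) * w (2 * i + 2))"
      by (simp add: b_def sum_distrib_left mult.assoc)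
    also have "\<dots> = (\<Sum>i<d. if i = k div 2 then (if odd k then w (k + 1) else 0) else 0)"
      using n that D by (intro sum.cong) (auto elim!: evenE oddE)
    also have "\<dots> = (if odd k then w (k + 1) else 0)"
      using that by (subst sum.delta) (auto elim!: evenE oddE)
    finally show ?thesis .
  qed
  have "a * a = (\<Sum>i<d. v (2 * i) * (w (2 * i + 1) * a))"
    by (subst (1) a_def) (simp add: sum_distrib_right mult.assoc)
  also have "\<dots> = 0" by (rule sum.neutral) (auto simp: wa)
  finally have aa: "a ^ 2 = 0" by (simp add: power2_eq_square)
  have "b * b = (\<Sum>i<d. v (2 * i + 1) * (w (2 * i + 2) * b))"
    by (subst (1) b_def) (simp add: sum_distrib_right mult.assoc)
  also have "\<dots> = 0" by (rule sum.neutral) (auto simp: wb)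
  finally have bb: "b ^ 2 = 0" by (simp add: power2_eq_square)
  have wab: "w 0 * (a * b) ^ i = w (2 * i)" if "i \<le> d" for i
    using that
  proof (induction i)
    case (Suc i)
    have "w 0 * (a * b) ^ Suc i = w (2 * i) * a * b"
      unfolding power_Suc2 mult.assoc[symmetric] using Suc by simp
    also have "\<dots> = w (2 * Suc i)" using Suc.prems by (simp add: wa wb)
    finally show ?case .
  qed simp
  \<comment> \<open>Started at \<open>w 0\<close>, each factor \<open>a * b\<close> advances the
    index by 2, so pairing with \<open>v (2 * d)\<close> picks out the leading coefficient of
    \<open>g\<close>.\<close>
  have "0 = w 0 * alg_poly scale g (a * b) * v (2 * d)"
    using P1 aa bb by (simp add: property_P1_def)
  also have "\<dots> = (\<Sum>i\<le>d. scale (Polynomial.coeff g i) (w 0 * (a * b) ^ i * v (2 * d)))"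
    by (simp add: alg_poly_def d_def sum_distrib_left sum_distrib_right scale)
  also have "\<dots> = (\<Sum>i\<le>d. if i = d then scale (Polynomial.coeff g d) f else 0)"
    using n D(3) by (intro sum.cong) (auto simp: wab scale)
  also have "\<dots> = scale (Polynomial.coeff g d) f" by simp
  finally show False using f g scale(3)[of "Polynomial.coeff g d" f] by (simp add: d_def)
qed

text \<open>Left multiplication by each entry preserves the image of \<open>E\<close>, so a copy of
  \<open>E\<close> can be inserted behind every factor.\<close>

lemma prod_list_mult_absorb:
  fixes E :: "'a::monoid_mult"
  assumes "\<And>x. x \<in> set xs \<Longrightarrow> E * (x * E) = x * E" "xs \<noteq> []"
  shows "prod_list xs * E = prod_list (map (\<lambda>x. x * E) xs)"
  using assms
proof (induction xs)
  case (Cons x xs)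
  show ?case
  proof (cases xs)
    case (Cons y ys)
    have "E * prod_list (map (\<lambda>x. x * E) xs) = (E * (y * E)) * prod_list (map (\<lambda>x. x * E) ys)"
      by (simp add: Cons mult.assoc)
    also have "\<dots> = prod_list (map (\<lambda>x. x * E) xs)"
      using Cons.prems(1)[of y] \<open>xs = y # ys\<close> by simp
    finally have "E * prod_list (map (\<lambda>x. x * E) xs) = prod_list (map (\<lambda>x. x * E) xs)" .
    moreover have "prod_list xs * E = prod_list (map (\<lambda>x. x * E) xs)"
      using Cons.prems \<open>xs = y # ys\<close> by (intro Cons.IH) auto
    ultimately show ?thesis by (simp add: mult.assoc)
  qed simp
qed simp

section \<open>Coordinates over the corner of a primitive idempotent\<close>

locale finite_regular_subring =
  fixes A :: "'a::ring_1 set"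
  assumes finite_A: "finite A"
    and one_A [simp]: "1 \<in> A"
    and diff_A [simp]: "x \<in> A \<Longrightarrow> y \<in> A \<Longrightarrow> x - y \<in> A"
    and mult_A [simp]: "x \<in> A \<Longrightarrow> y \<in> A \<Longrightarrow> x * y \<in> A"
    and regular: "x \<in> A \<Longrightarrow> \<exists>r\<in>A. x * r * x = x"
begin

lemma zero_A [simp]: "0 \<in> A"
  using diff_A[OF one_A one_A] by simp

lemma minus_A [simp]: "x \<in> A \<Longrightarrow> - x \<in> A"
  using diff_A[of 0 x] by simp

lemma add_A [simp]: "x \<in> A \<Longrightarrow> y \<in> A \<Longrightarrow> x + y \<in> A"
  using diff_A[of x "- y"] by simp

lemma sum_A: "(\<And>i. i \<in> I \<Longrightarrow> h i \<in> A) \<Longrightarrow> sum h I \<in> A"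
  by (induction I rule: infinite_finite_induct) auto

end

locale primitive_idempotent = finite_regular_subring +
  fixes f
  assumes f_A [simp]: "f \<in> A" and f_idem [simp]: "f * f = f" and f_nz [simp]: "f \<noteq> 0"
    and primitive: "h \<in> A \<Longrightarrow> h * h = h \<Longrightarrow> f * h = h \<Longrightarrow> h * f = h \<Longrightarrow> h \<noteq> 0 \<Longrightarrow> h = f"
begin

definition corner where "corner = {x \<in> A. f * x = x \<and> x * f = x}"

lemma cornerD:
  assumes "x \<in> corner"
  shows "x \<in> A" "f * x = x" "x * f = x"
  using assms unfolding corner_def by blast+

text \<open>With \<open>y * r * y = y\<close>, the element \<open>f * r * y\<close> is an idempotent
  below \<open>f\<close>, and it is nonzero because \<open>y\<close> times it is \<open>y\<close>.
  Primitivity makes it \<open>f\<close>. This both makes the corner a domain and supplies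
  functionals that are nonzero on a given vector.\<close>

lemma left_inverse:
  assumes "y \<in> A" "y * f = y" "y \<noteq> 0"
  shows "\<exists>r\<in>A. f * r * y = f"
proof -
  obtain r where r: "r \<in> A" "y * r * y = y" using regular assms(1) by blast
  define h where "h = f * r * y"
  have yh: "y * h = y" unfolding h_def mult.assoc[symmetric] assms(2) r(2) by (rule refl)
  have "h * h = f * r * (y * h)" by (simp only: h_def mult.assoc)
  then have "h * h = h" unfolding yh by (simp only: h_def)
  moreover have "f * h = h" by (simp add: h_def flip: mult.assoc)
  moreover have "h * f = h" using assms(2) by (simp add: h_def mult.assoc)
  moreover have "h \<noteq> 0" using yh assms(3) by auto
  moreover have "h \<in> A" using r assms by (simp add: h_def)
  ultimately have "h = f" using primitive by blast
  then show ?thesis using r h_def by auto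
qed

lemma finite_domain_corner: "finite_domain corner f"
proof
  show "finite corner" by (rule finite_subset[OF _ finite_A]) (auto simp: corner_def)
  show "x * y = 0 \<Longrightarrow> x = 0 \<or> y = 0" if xy: "x \<in> corner" "y \<in> corner" for x y
  proof (rule disjCI)
    assume 0: "x * y = 0" and "y \<noteq> 0"
    then have "x \<noteq> 0 \<Longrightarrow> False"
    proof -
      assume "x \<noteq> 0"
      then obtain r where "f * r * x = f" using left_inverse cornerD[OF xy(1)] by blast
      then have "f * y = f * r * (x * y)" by (simp flip: mult.assoc)
      then show False using 0 \<open>y \<noteq> 0\<close> cornerD[OF xy(2)] by simp
    qed
    then show "x = 0" by blast
  qed
  show "x * y \<in> corner" if "x \<in> corner" "y \<in> corner" for x y
    using cornerD[OF that(1)] cornerD[OF that(2)] by (simp add: corner_def mult.assoc) (simp flip: mult.assoc)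
qed (auto simp: corner_def algebra_simps)

lemma corner_commute: "x \<in> corner \<Longrightarrow> y \<in> corner \<Longrightarrow> x * y = y * x"
  using finite_domain_commute[OF finite_domain_corner] .

text \<open>A Gram-Schmidt step: \<open>E\<close> projects onto the span of the \<open>v i\<close>,
  so \<open>y = x - E * x\<close> is annihilated by all old functionals. A left inverse of
  \<open>y\<close>, composed with \<open>1 - E\<close> to annihilate the old vectors, is the new
  functional.\<close>

lemma extend_dual_system:
  assumes dual: "dual_system n f v w" and vw: "\<And>i. i < n \<Longrightarrow> v i \<in> A \<and> w i \<in> A"
    and x: "x \<in> A" "x * f = x" "(\<Sum>i<n. v i * w i) * x \<noteq> x"
  shows "\<exists>v' w'. dual_system (Suc n) f v' w' \<and> (\<forall>i<Suc n. v' i \<in> A \<and> w' i \<in> A)"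
proof -
  note D = dual_systemD[OF dual]
  define E where "E = (\<Sum>i<n. v i * w i)"
  have EA: "E \<in> A" unfolding E_def using vw by (intro sum_A) auto
  have wE: "w k * E = w k" if k: "k < n" for k
  proof -
    have "w k * E = (\<Sum>i<n. (w k * v i) * w i)" by (simp add: E_def sum_distrib_left mult.assoc)
    also have "\<dots> = (\<Sum>i<n. if i = k then w k else 0)" using k D by (intro sum.cong) auto
    finally show ?thesis using k by simp
  qed
  have Ev: "E * v k = v k" if k: "k < n" for k
  proof -
    have "E * v k = (\<Sum>i<n. v i * (w i * v k))" by (simp add: E_def sum_distrib_right mult.assoc)
    also have "\<dots> = (\<Sum>i<n. if i = k then v k else 0)" using k D by (intro sum.cong) auto
    finally show ?thesis using k by simp
  qed
  define y where "y = x - E * x"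
  have y: "y \<in> A" "y * f = y" "y \<noteq> 0"
    using x EA by (auto simp: y_def E_def left_diff_distrib mult.assoc)
  have wy: "w k * y = 0" if "k < n" for k
    using wE[OF that] by (simp add: y_def right_diff_distrib flip: mult.assoc)
  have Ey: "E * y = 0" unfolding E_def sum_distrib_right using wy by (intro sum.neutral) (simp add: mult.assoc)
  obtain r where r: "r \<in> A" "f * r * y = f" using left_inverse y by blast
  define z where "z = f * r * (1 - E)"
  have zA: "z \<in> A" using r EA by (simp add: z_def)
  have fz: "f * z = z" by (simp add: z_def flip: mult.assoc)
  have zy: "z * y = f"
  proof -
    have "z * y = f * r * y - f * r * (E * y)" by (simp add: z_def algebra_simps)
    then show ?thesis using r Ey by simp
  qed
  have zv: "z * v k = 0" if "k < n" for k
  proof -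
    have "z * v k = f * r * (v k - E * v k)" by (simp add: z_def algebra_simps)
    then show ?thesis using Ev[OF that] by simp
  qed
  have "dual_system (Suc n) f (v(n := y)) (w(n := z))"
    using D y fz zy zv wy by (simp add: dual_system_def less_Suc_eq all_conj_distrib)
  moreover have "\<forall>i<Suc n. (v(n := y)) i \<in> A \<and> (w(n := z)) i \<in> A"
    using vw y zA by (auto simp: less_Suc_eq)
  ultimately show ?thesis by blast
qed

lemma exists_complete_dual_system:
  assumes bound: "\<And>n v w. dual_system n f v w \<Longrightarrow> n \<le> m"
  shows "\<exists>n v w. dual_system n f v w \<and> n \<le> m \<and> (\<forall>i<n. v i \<in> A \<and> w i \<in> A) \<and>
    (\<forall>x\<in>A. x * f = x \<longrightarrow> (\<Sum>i<n. v i * w i) * x = x)"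
proof -
  define P where "P n \<longleftrightarrow> (\<exists>v w. dual_system n f v w \<and> (\<forall>i<n. v i \<in> A \<and> w i \<in> A))" for n
  have "P 0" by (simp add: P_def dual_system_def)
  moreover have Pm: "P n \<Longrightarrow> n \<le> m" for n using bound by (auto simp: P_def)
  ultimately obtain n where n: "P n" "\<And>k. P k \<Longrightarrow> k \<le> n"
    using GreatestI_nat[of P 0 m] Greatest_le_nat[of P _ m] by blast
  then obtain v w where vw: "dual_system n f v w" "\<And>i. i < n \<Longrightarrow> v i \<in> A \<and> w i \<in> A"
    unfolding P_def by blast
  have "\<forall>x\<in>A. x * f = x \<longrightarrow> (\<Sum>i<n. v i * w i) * x = x"
  proof (intro ballI impI, rule ccontr)
    fix x assume that: "x \<in> A" "x * f = x"
    assume "(\<Sum>i<n. v i * w i) * x \<noteq> x"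
    then have "P (Suc n)" using extend_dual_system[OF vw that] unfolding P_def by blast
    then show False using n(2)[of "Suc n"] by simp
  qed
  moreover have "\<forall>i<n. v i \<in> A \<and> w i \<in> A" using vw(2) by simp
  ultimately show ?thesis using vw(1) bound[OF vw(1)] by (intro exI conjI)
qed

text \<open>For a complete system, \<open>E\<close> is the identity on \<open>A f\<close>, and
  \<open>A\<close> acts by matrices over the commutative corner. Hence each \<open>a i * E\<close>
  is a combination of at most \<open>m * m\<close> matrix units \<open>v j * w k\<close> with scalar
  coefficients, on which a standard polynomial of degree \<open>N\<close> vanishes. Since
  \<open>E * f = f\<close>, nothing is lost by passing to the \<open>a i * E\<close>.\<close>

lemma standard_poly_mult_idempotent:
  assumes bound: "\<And>n v w. dual_system n f v w \<Longrightarrow> n \<le> m" and N: "m * m < N"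
    and a: "\<And>i. i \<in> {1..N} \<Longrightarrow> a i \<in> A"
  shows "standard_poly N a * f = 0"
proof -
  obtain n v w where dual: "dual_system n f v w" and n: "n \<le> m"
    and vw: "\<And>i. i < n \<Longrightarrow> v i \<in> A" "\<And>i. i < n \<Longrightarrow> w i \<in> A"
    and complete: "\<And>x. x \<in> A \<Longrightarrow> x * f = x \<Longrightarrow> (\<Sum>i<n. v i * w i) * x = x"
  proof -
    have "\<exists>n v w. dual_system n f v w \<and> n \<le> m \<and> (\<forall>i<n. v i \<in> A \<and> w i \<in> A) \<and>
        (\<forall>x\<in>A. x * f = x \<longrightarrow> (\<Sum>i<n. v i * w i) * x = x)"
      by (rule exists_complete_dual_system) (rule bound)
    then show thesis using that by (elim exE conjE) simp
  qed
  note D = dual_systemD[OF dual]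
  define E where "E = (\<Sum>i<n. v i * w i)"
  note complete = complete[folded E_def]
  have Eav: "E * (x * v k) = x * v k" if "x \<in> A" "k < n" for x k
    using complete[of "x * v k"] that vw D by (simp add: mult.assoc)
  have EaE: "E * (x * E) = x * E" if "x \<in> A" for x
  proof -
    have "x * E = (\<Sum>k<n. x * v k * w k)" by (simp add: E_def sum_distrib_left mult.assoc)
    then have "E * (x * E) = (\<Sum>k<n. E * (x * v k) * w k)" by (simp add: sum_distrib_left mult.assoc)
    also have "\<dots> = (\<Sum>k<n. x * v k * w k)" using Eav[OF that] by (intro sum.cong) auto
    finally show ?thesis by (simp add: \<open>x * E = _\<close>)
  qed
  \<comment> \<open>The scalar matrix with entry \<open>z\<close>: it realizes right multiplication
    by \<open>z\<close> on the \<open>v k\<close> as a left multiplication, and so commutes with all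
    matrix units.\<close>
  define \<Delta> where "\<Delta> z = (\<Sum>l<n. v l * z * w l)" for z
  have w\<Delta>: "w k * \<Delta> z = z * w k" if "k < n" "z \<in> corner" for k z
  proof -
    have "w k * \<Delta> z = (\<Sum>l<n. (w k * v l) * z * w l)" by (simp add: \<Delta>_def sum_distrib_left mult.assoc)
    also have "\<dots> = (\<Sum>l<n. if l = k then z * w k else 0)"
      using that D cornerD[OF that(2)] by (intro sum.cong) auto
    finally show ?thesis using that by simp
  qed
  have \<Delta>v: "\<Delta> z * v k = v k * z" if "k < n" "z \<in> corner" for k z
  proof -
    have "\<Delta> z * v k = (\<Sum>l<n. v l * z * (w l * v k))" by (simp add: \<Delta>_def sum_distrib_right mult.assoc)
    also have "\<dots> = (\<Sum>l<n. if l = k then v k * z else 0)"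
      using that D cornerD[OF that(2)] by (intro sum.cong) (auto simp: mult.assoc)
    finally show ?thesis using that by simp
  qed
  have \<Delta>\<Delta>: "\<Delta> y * \<Delta> z = (\<Sum>l<n. v l * (y * z) * w l)" if "z \<in> corner" for y z
  proof -
    have "\<Delta> y * \<Delta> z = (\<Sum>l<n. v l * y * (w l * \<Delta> z))"
      by (simp add: \<Delta>_def[of y] sum_distrib_right mult.assoc)
    also have "\<dots> = (\<Sum>l<n. v l * (y * z) * w l)"
      using that by (intro sum.cong) (auto simp: w\<Delta> mult.assoc)
    finally show ?thesis .
  qed
  have wav: "w j * x * v k \<in> corner" if "x \<in> A" "j < n" "k < n" for x j k
  proof -
    have "f * (w j * x * v k) = w j * x * v k" using D(2)[OF that(2)] by (simp flip: mult.assoc)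
    moreover have "w j * x * v k * f = w j * x * v k" using D(1)[OF that(3)] by (simp add: mult.assoc)
    ultimately show ?thesis using that vw by (simp add: corner_def)
  qed
  let ?T = "{..<n} \<times> {..<n}"
  define b where "b = (\<lambda>(j, k). v j * w k)"
  define z where "z = (\<lambda>i (j, k). \<Delta> (w j * a i * v k))"
  have "standard_poly N (\<lambda>i. a i * E) = 0"
  proof (rule standard_poly_eq_0_of_central_span[where T = ?T and b = b and z = z])
    have "n * n \<le> m * m" using n by (rule mult_le_mono) (rule n)
    then show "card ?T < N" using N by simp
    fix i assume i: "i \<in> {1..N}"
    note aA = a[OF i]
    have "a i * E = E * (a i * E)" using EaE[OF aA] by simp
    also have "\<dots> = (\<Sum>j<n. \<Sum>k<n. v j * (w j * a i * v k) * w k)"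
      by (subst sum.swap) (simp add: E_def sum_distrib_left sum_distrib_right mult.assoc)
    also have "\<dots> = (\<Sum>j<n. \<Sum>k<n. b (j, k) * z i (j, k))"
      using wav[OF aA] by (intro sum.cong refl) (simp add: b_def z_def w\<Delta> mult.assoc)
    also have "\<dots> = (\<Sum>t\<in>?T. b t * z i t)" by (simp add: sum.cartesian_product)
    finally show "a i * E = (\<Sum>t\<in>?T. b t * z i t)" .
    fix t u assume t: "t \<in> ?T" "u \<in> ?T"
    then obtain j k j' k' where tu: "t = (j, k)" "u = (j', k')" "j < n" "k < n" "j' < n" "k' < n" by auto
    define c where "c = w j' * a i * v k'"
    have c: "c \<in> corner" unfolding c_def using wav[OF aA] tu by blast
    have "v j * (w k * \<Delta> c) = (\<Delta> c * v j) * w k"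
      using w\<Delta>[OF _ c] \<Delta>v[OF _ c] tu by (simp add: mult.assoc)
    then show "b t * z i u = z i u * b t" by (simp add: tu b_def z_def c_def mult.assoc)
    fix i' assume i': "i' \<in> {1..N}"
    define c' where "c' = w j * a i' * v k"
    have c': "c' \<in> corner" unfolding c'_def using wav[OF a[OF i']] tu by blast
    have "\<Delta> c * \<Delta> c' = \<Delta> c' * \<Delta> c"
      unfolding \<Delta>\<Delta>[OF c] \<Delta>\<Delta>[OF c'] corner_commute[OF c c'] by (rule refl)
    then show "z i u * z i' t = z i' t * z i u" by (simp add: tu z_def c_def c'_def)
  qed auto
  moreover have "standard_poly N a * E = standard_poly N (\<lambda>i. a i * E)"
    unfolding standard_poly_def sum_distrib_right
  proof (rule sum.cong[OF refl])
    fix \<sigma> assume \<sigma>: "\<sigma> \<in> {\<sigma>. \<sigma> permutes {1..N}}"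
    let ?xs = "map (\<lambda>i. a (\<sigma> i)) [1..<Suc N]"
    have "\<sigma> i \<in> {1..N}" if "i \<in> {1..N}" for i using that \<sigma> permutes_in_image[of \<sigma> "{1..N}" i] by simp
    then have "set ?xs \<subseteq> A" using a by (auto simp del: upt_Suc)
    moreover have "?xs \<noteq> []" using N by simp
    ultimately have "prod_list ?xs * E = prod_list (map (\<lambda>x. x * E) ?xs)"
      using EaE by (intro prod_list_mult_absorb) auto
    then show "of_int (sign \<sigma>) * prod_list ?xs * E
        = of_int (sign \<sigma>) * prod_list (map (\<lambda>i. a (\<sigma> i) * E) [1..<Suc N])"
      by (simp add: mult.assoc o_def del: upt_Suc)
  qed
  moreover have "E * f = f" using complete by simp
  ultimately have "standard_poly N a * E * f = 0" "E * f = f" by simp_all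
  then show ?thesis by (simp only: mult.assoc)
qed

end

text \<open>No decomposition of 1 into primitive idempotents is required. Among the idempotents
  \<open>f\<close> with \<open>s * f \<noteq> 0\<close> one with smallest \<open>A f\<close> is
  primitive: for a proper \<open>h\<close> below it, \<open>s * h\<close> or
  \<open>s * (f - h)\<close> would be nonzero while the left ideal shrinks.\<close>

lemma (in finite_regular_subring) standard_poly_eq_0:
  fixes scale :: "'k::field \<Rightarrow> 'a \<Rightarrow> 'a"
  assumes P1: "property_P1 scale g" and g: "g \<noteq> 0"
    and scale: "\<And>c x y. x * scale c y = scale c (x * y)" "\<And>c x y. scale c x * y = scale c (x * y)"
      "\<And>c x. scale c x = 0 \<longleftrightarrow> c = 0 \<or> x = 0"
    and N: "(2 * Polynomial.degree g) * (2 * Polynomial.degree g) < N"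
    and a: "\<And>i. i \<in> {1..N} \<Longrightarrow> a i \<in> A"
  shows "standard_poly N a = 0"
proof (rule ccontr)
  define s where "s = standard_poly N a"
  assume "standard_poly N a \<noteq> 0"
  then have "1 \<in> A \<and> 1 * 1 = (1::'a) \<and> s * 1 \<noteq> 0" by (simp add: s_def)
  then obtain f where f: "f \<in> A" "f * f = f" "s * f \<noteq> 0"
    and least: "\<And>h. h \<in> A \<and> h * h = h \<and> s * h \<noteq> 0 \<Longrightarrow> card ((\<lambda>x. x * f) ` A) \<le> card ((\<lambda>x. x * h) ` A)"
    using ex_has_least_nat[of "\<lambda>f. f \<in> A \<and> f * f = f \<and> s * f \<noteq> 0" 1 "\<lambda>f. card ((\<lambda>x. x * f) ` A)"]
    by blast
  have less: "card ((\<lambda>x. x * h) ` A) < card ((\<lambda>x. x * f) ` A)"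
    if h: "h \<in> A" "h * h = h" "h * f = h" "f * h = h" "h \<noteq> f" for h
  proof (rule psubset_card_mono)
    have "(\<lambda>x. x * h) ` A \<subseteq> (\<lambda>x. x * f) ` A"
    proof
      fix y assume "y \<in> (\<lambda>x. x * h) ` A"
      then obtain x where "x \<in> A" "y = x * h" by blast
      then have "y = (x * h) * f" "x * h \<in> A" using h by (simp_all add: mult.assoc)
      then show "y \<in> (\<lambda>x. x * f) ` A" by blast
    qed
    moreover have "f \<in> (\<lambda>x. x * f) ` A" using f by (intro image_eqI[of _ _ f]) auto
    moreover have "f \<notin> (\<lambda>x. x * h) ` A"
    proof
      assume "f \<in> (\<lambda>x. x * h) ` A"
      then obtain x where "f = x * h" by blast
      then have "f * h = f" using h by (simp add: mult.assoc)
      with h show False by simp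
    qed
    ultimately show "(\<lambda>x. x * h) ` A \<subset> (\<lambda>x. x * f) ` A" by blast
  qed (use finite_A in auto)
  interpret primitive_idempotent A f
  proof
    show "f \<noteq> 0" using f by auto
    fix h assume h: "h \<in> A" "h * h = h" "f * h = h" "h * f = h" "h \<noteq> 0"
    show "h = f"
    proof (rule ccontr)
      assume "h \<noteq> f"
      define h' where "h' = f - h"
      have h': "h' \<in> A" "h' * h' = h'" "h' * f = h'" "f * h' = h'" "h' \<noteq> f"
        using h f by (auto simp: h'_def algebra_simps)
      have "s * f = s * h + s * h'" by (simp add: h'_def algebra_simps)
      then have "s * h \<noteq> 0 \<or> s * h' \<noteq> 0" using f by auto
      then show False
        using least[of h] least[of h'] less[of h] less[of h'] h h' \<open>h \<noteq> f\<close> by auto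
    qed
  qed (use f in auto)
  have bound: "n \<le> 2 * Polynomial.degree g" if "dual_system n f v w" for n v w
    using dual_system_size_le[OF P1 g scale that f_nz] .
  have "s * f = 0" unfolding s_def
  proof (rule standard_poly_mult_idempotent[OF _ N])
    show "n \<le> 2 * Polynomial.degree g" if "dual_system n f v w" for n v w by (rule bound[OF that])
    show "a i \<in> A" if "i \<in> {1..N}" for i by (rule a[OF that])
  qed
  with f show False by simp
qed

section \<open>Groups with normal cyclic subgroups\<close>

lemma power_of_unique_prime_divisor:
  fixes n p :: nat
  assumes "\<And>q. prime q \<Longrightarrow> q dvd n \<Longrightarrow> q = p" "n > 0"
  shows "\<exists>a. n = p ^ a"
  using assms
proof (induction n rule: less_induct)
  case (less n)
  show ?case
  proof (cases "n = 1")
    case True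
    then show ?thesis by (intro exI[of _ 0]) simp
  next
    case False
    then obtain q where q: "prime q" "q dvd n" using prime_factor_nat by blast
    then have "p dvd n" "prime p" using less.prems by auto
    then obtain k where k: "n = p * k" by blast
    then have "k < n" "k > 0" using less.prems(2) prime_gt_1_nat[OF \<open>prime p\<close>] by auto
    moreover have "\<And>q. prime q \<Longrightarrow> q dvd k \<Longrightarrow> q = p" using less.prems(1) k by simp
    ultimately obtain a where "k = p ^ a" using less.IH by blast
    then show ?thesis using k by (intro exI[of _ "Suc a"]) simp
  qed
qed

text \<open>A torsion submonoid is a group, so normality of the subgroup generated by
  \<open>x\<close> can be stated without inverses. The ambient type is only a monoid because the
  elements will be the basis units of the group algebra under its multiplication.\<close>

locale dedekind_group =
  fixes S :: "'a::monoid_mult set"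
  assumes one_S [simp]: "1 \<in> S"
    and mult_S [simp]: "x \<in> S \<Longrightarrow> y \<in> S \<Longrightarrow> x * y \<in> S"
    and torsion: "x \<in> S \<Longrightarrow> \<exists>n>0. x ^ n = 1"
    and normal: "x \<in> S \<Longrightarrow> y \<in> S \<Longrightarrow> \<exists>k. y * x = x ^ k * y"
begin

lemma power_S [simp]: "x \<in> S \<Longrightarrow> x ^ n \<in> S"
  by (induction n) auto

definition ord :: "'a \<Rightarrow> nat" where "ord x = (LEAST n. n > 0 \<and> x ^ n = 1)"

lemma ord:
  assumes "x \<in> S"
  shows "ord x > 0" "x ^ ord x = 1"
  using LeastI_ex[OF torsion[OF assms]] unfolding ord_def by blast+

lemma ord_le: "n > 0 \<Longrightarrow> x ^ n = 1 \<Longrightarrow> ord x \<le> n"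
  unfolding ord_def by (rule Least_le) simp

lemma power_mod_ord:
  assumes "x \<in> S"
  shows "x ^ (n mod ord x) = x ^ n"
proof -
  have "x ^ n = x ^ (ord x * (n div ord x) + n mod ord x)" by simp
  also have "\<dots> = x ^ (n mod ord x)" unfolding power_add power_mult by (simp add: ord assms)
  finally show ?thesis by simp
qed

lemma ord_dvd:
  assumes "x \<in> S" "x ^ n = 1"
  shows "ord x dvd n"
proof (rule ccontr)
  assume "\<not> ord x dvd n"
  then have "n mod ord x > 0" by (simp add: mod_greater_zero_iff_not_dvd)
  then have "ord x \<le> n mod ord x" using power_mod_ord assms by (intro ord_le) auto
  then show False using mod_less_divisor[OF ord(1)[OF assms(1)], of n] by simp
qed

lemma inverse_ex:
  assumes "x \<in> S"
  shows "\<exists>y\<in>S. y * x = 1 \<and> x * y = 1"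
proof (intro bexI conjI)
  have "Suc (ord x - 1) = ord x" using ord(1)[OF assms] by simp
  then show "x * x ^ (ord x - 1) = 1" "x ^ (ord x - 1) * x = 1"
    using ord(2)[OF assms] by (metis power_Suc, metis power_Suc2)
qed (use assms in simp)

lemma left_cancel_S: "x \<in> S \<Longrightarrow> x * y = x * z \<Longrightarrow> y = z"
  using inverse_ex by (metis mult.assoc mult_1_left)

lemma right_cancel_S: "x \<in> S \<Longrightarrow> y * x = z * x \<Longrightarrow> y = z"
  using inverse_ex by (metis mult.assoc mult_1_right)

text \<open>Take a noncommuting pair with the sum of orders minimal. Its commutator \<open>c\<close>
  lies in both cyclic groups, hence commutes with both elements. For a prime \<open>q\<close>
  dividing the order of one of them, its \<open>q\<close>-th power commutes with the other by
  minimality, so \<open>c ^ q = 1\<close>; therefore both orders are powers of one prime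
  \<open>p\<close>. Replacing \<open>y\<close> by a suitable \<open>y * x ^ m\<close> would lower
  the order further unless \<open>p = 2\<close> and both orders are 4.\<close>

lemma exists_quaternion_pair:
  assumes uv: "u \<in> S" "v \<in> S" "u * v \<noteq> v * u"
  shows "\<exists>x\<in>S. \<exists>y\<in>S. y * x = x ^ 2 * (x * y) \<and> y ^ 2 = x ^ 2 \<and> x ^ 4 = 1 \<and> x ^ 2 \<noteq> 1"
proof -
  define P where "P = (\<lambda>(x, y). x \<in> S \<and> y \<in> S \<and> x * y \<noteq> y * x)"
  define \<mu> where "\<mu> = (\<lambda>(x, y). ord x + ord y)"
  have "P (u, v)" using uv by (simp add: P_def)
  then obtain t where t: "P t" "\<And>t'. P t' \<Longrightarrow> \<mu> t \<le> \<mu> t'"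
    using ex_has_least_nat[of P "(u, v)" \<mu>] by blast
  obtain x y where xy: "x \<in> S" "y \<in> S" "x * y \<noteq> y * x" and le: "ord y \<le> ord x"
    and min: "\<And>x' y'. x' \<in> S \<Longrightarrow> y' \<in> S \<Longrightarrow> x' * y' \<noteq> y' * x' \<Longrightarrow> ord x + ord y \<le> ord x' + ord y'"
  proof (cases "ord (snd t) \<le> ord (fst t)")
    case True
    then show thesis using that[of "fst t" "snd t"] t by (auto simp: P_def \<mu>_def case_prod_beta)
  next
    case False
    have "\<And>x' y'. x' \<in> S \<Longrightarrow> y' \<in> S \<Longrightarrow> x' * y' \<noteq> y' * x' \<Longrightarrow> ord (fst t) + ord (snd t) \<le> ord x' + ord y'"
      using t(2) by (auto simp: P_def \<mu>_def case_prod_beta)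
    then show thesis using that[of "snd t" "fst t"] t(1) False
      by (auto simp: P_def case_prod_beta add.commute)
  qed
  obtain k where k: "y * x = x ^ k * y" using normal xy by blast
  have "k \<noteq> 0"
  proof
    assume "k = 0"
    then have "y * x = y * 1" using k by simp
    then have "x = 1" using left_cancel_S xy by blast
    then show False using xy by simp
  qed
  define c where "c = x ^ (k - 1)"
  have "x ^ k = c * x" using \<open>k \<noteq> 0\<close> by (simp add: c_def flip: power_Suc2)
  then have yx: "y * x = c * (x * y)" using k by (simp add: mult.assoc)
  have cx: "c * x = x * c" by (simp add: c_def power_commutes)
  have cS: "c \<in> S" using xy by (simp add: c_def)
  have c1: "c \<noteq> 1" using yx xy by auto
  obtain l where l: "x * y = y ^ l * x" using normal xy by blast
  have "c * y ^ l = y"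
  proof -
    have "c * y ^ l * x = y * x" unfolding yx l by (simp add: mult.assoc)
    then show ?thesis using right_cancel_S xy by blast
  qed
  moreover have "y ^ l * y ^ (l * (ord y - 1)) = 1"
  proof -
    have "l + l * (ord y - 1) = ord y * l" using ord(1)[OF xy(2)] by (cases "ord y") auto
    then have "y ^ l * y ^ (l * (ord y - 1)) = y ^ (ord y * l)" by (simp only: power_add[symmetric])
    then show ?thesis by (simp add: ord xy power_mult)
  qed
  ultimately have "y * y ^ (l * (ord y - 1)) = c" by (metis mult.assoc mult_1_right)
  then have "c = y ^ Suc (l * (ord y - 1))" by simp
  then obtain j where j: "c = y ^ j" by blast
  have cy: "c * y = y * c" by (simp add: j power_commutes)
  note yxn = quasi_commute_power[OF yx cx] and ynx = quasi_commute_power_left[OF yx cy]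
  have ord_power_less: "ord (w ^ q) < ord w" if w: "w \<in> S" "prime q" "q dvd ord w" for w q
  proof -
    obtain m where m: "ord w = q * m" using w by blast
    then have "m > 0" "m < ord w" using ord(1)[OF w(1)] prime_gt_1_nat[OF w(2)] by auto
    moreover have "(w ^ q) ^ m = 1" using ord(2)[OF w(1)] m by (simp flip: power_mult)
    ultimately show ?thesis using ord_le[of m "w ^ q"] by simp
  qed
  have cq_x: "c ^ q = 1" if "prime q" "q dvd ord x" for q
  proof (rule ccontr)
    assume "c ^ q \<noteq> 1"
    then have "c ^ q * (x ^ q * y) \<noteq> 1 * (x ^ q * y)" using right_cancel_S[of "x ^ q * y"] xy by auto
    then have "x ^ q * y \<noteq> y * x ^ q" using yxn[of q] by simp
    then show False using min[of "x ^ q" y] ord_power_less[OF xy(1) that] xy by simp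
  qed
  have cq_y: "c ^ q = 1" if "prime q" "q dvd ord y" for q
  proof (rule ccontr)
    assume "c ^ q \<noteq> 1"
    then have "c ^ q * (x * y ^ q) \<noteq> 1 * (x * y ^ q)" using right_cancel_S[of "x * y ^ q"] xy by auto
    then have "x * y ^ q \<noteq> y ^ q * x" using ynx[of q] by simp
    then show False using min[of x "y ^ q"] ord_power_less[OF xy(2) that] xy by simp
  qed
  have ordc: "ord c \<noteq> 1" using c1 ord(2)[OF cS] by auto
  have "ord x \<noteq> 1" using xy ord(2)[OF xy(1)] by auto
  then obtain p where p: "prime p" "p dvd ord x" using prime_factor_nat by blast
  have cp: "c ^ p = 1" using cq_x[OF p] .
  have ordcp: "ord c = p" using ord_dvd[OF cS cp] ordc p(1) prime_nat_iff by blast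
  have uniq: "q = p" if "prime q" "c ^ q = 1" for q
    using ord_dvd[OF cS that(2)] ordcp p(1) that(1) primes_dvd_imp_eq by blast
  have "\<exists>a. ord x = p ^ a"
    by (rule power_of_unique_prime_divisor) (use uniq cq_x ord xy in auto)
  then obtain a' where a': "ord x = p ^ a'" by blast
  have "\<exists>b. ord y = p ^ b"
    by (rule power_of_unique_prime_divisor) (use uniq cq_y ord xy in auto)
  then obtain b' where b': "ord y = p ^ b'" by blast
  have "a' \<noteq> 0" using a' \<open>ord x \<noteq> 1\<close> by (cases a') auto
  moreover have "b' \<noteq> 0"
  proof
    assume "b' = 0"
    then have "y = 1" using b' ord(2)[OF xy(2)] by simp
    then show False using xy by simp
  qed
  ultimately obtain a b where ab: "ord x = p ^ Suc a" "ord y = p ^ Suc b"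
    using a' b' by (metis not0_implies_Suc)
  have "b \<le> a" using le p(1) prime_gt_1_nat[OF p(1)] unfolding ab by (simp del: power_Suc)
  define M N where "M = p ^ a" and "N = p ^ b"
  have MN: "ord x = M * p" "ord y = N * p" "M > 0" "N > 0" "p > 0"
    using ab prime_gt_0_nat[OF p(1)] by (simp_all add: M_def N_def)
  have "x ^ ((k - 1) * p) = 1" using cp by (simp add: c_def power_mult)
  then have "M dvd k - 1" using ord_dvd[OF xy(1)] MN by fastforce
  then obtain i where "k - 1 = M * i" by blast
  then have ci: "c = x ^ (M * i)" by (simp add: c_def)
  have "y ^ (j * p) = 1" using cp by (simp add: j power_mult)
  then have "N dvd j" using ord_dvd[OF xy(2)] MN by fastforce
  then obtain j' where j': "j = N * j'" by blast
  have pi: "\<not> p dvd i"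
  proof
    assume "p dvd i"
    then obtain w where "i = p * w" by blast
    then have "c = x ^ (ord x * w)" by (simp add: ci MN mult.assoc)
    then show False using c1 by (simp add: power_mult ord xy)
  qed
  have pj: "\<not> p dvd j'"
  proof
    assume "p dvd j'"
    then obtain w where "j' = p * w" by blast
    then have "c = y ^ (ord y * w)" by (simp add: j j' MN mult.assoc)
    then show False using c1 by (simp add: power_mult ord xy)
  qed
  then have "coprime j' p" using p(1) by (metis prime_imp_coprime coprime_commute)
  \<comment> \<open>Since \<open>c = y ^ (N * j')\<close> and \<open>y ^ N\<close> has order
    \<open>p\<close>, inverting \<open>j'\<close> modulo \<open>p\<close> expresses
    \<open>y ^ N\<close> as a power of \<open>c\<close>.\<close>
  then obtain s where s: "[j' * s = Suc 0] (mod p)" using cong_solve_coprime_nat by blast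
  have yN: "y ^ N = c ^ s"
  proof -
    have "(N * (j' * s)) mod ord y = N mod ord y"
      using s unfolding MN cong_def by (metis mod_mult_mult1 mult.right_neutral One_nat_def)
    then have "y ^ (N * (j' * s)) = y ^ N" using power_mod_ord[OF xy(2)] by metis
    then show ?thesis by (simp add: j j' mult.assoc flip: power_mult)
  qed
  \<comment> \<open>Chosen so that \<open>(x ^ m) ^ N\<close> is inverse to
    \<open>y ^ N = c ^ s\<close>: the factor \<open>p ^ (a - b)\<close> turns \<open>N\<close> into
    \<open>M\<close>, \<open>x ^ (M * i)\<close> is \<open>c\<close>, and \<open>p - 1\<close>
    stands for -1 modulo \<open>p\<close>.\<close>
  define m where "m = p ^ (a - b) * (i * s * (p - 1))"
  have xm: "(x ^ m) ^ N * y ^ N = 1"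
  proof -
    have "m * N = M * i * (s * (p - 1))"
      using \<open>b \<le> a\<close> by (simp add: m_def M_def N_def mult_ac flip: power_add)
    then have "(x ^ m) ^ N = c ^ (s * (p - 1))" unfolding ci by (simp add: mult.assoc flip: power_mult)
    then have "(x ^ m) ^ N * y ^ N = c ^ (s * (p - 1) + s)" by (simp add: yN power_add)
    also have "s * (p - 1) + s = p * s" using MN(5) by (cases p) auto
    finally show ?thesis by (simp add: power_mult cp)
  qed
  have mc: "c ^ m * y = y * c ^ m" using cy by (rule power_commuting_commutes)
  have mcx: "c ^ m * x ^ m = x ^ m * c ^ m"
    by (rule power_commuting_commutes, rule power_commuting_commutes[symmetric]) (rule cx[symmetric])
  define T where "T = (\<Sum>i\<le>N. i)"
  have "(y * x ^ m) ^ N = c ^ (m * T)"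
    unfolding quasi_commute_mult_power[OF yxn mc mcx] xm T_def by (simp add: power_mult)
  \<comment> \<open>The modified pair still does not commute, so \<open>y * x ^ m\<close> cannot
    have order at most \<open>N\<close>. Its \<open>N\<close>-th power \<open>c ^ (m * T)\<close> is
    thus not 1, and \<open>p\<close> divides neither \<open>m\<close> nor the triangular number
    \<open>T\<close>.\<close>
  moreover have "x * (y * x ^ m) \<noteq> (y * x ^ m) * x"
  proof
    assume "x * (y * x ^ m) = (y * x ^ m) * x"
    also have "\<dots> = y * x * x ^ m" by (simp add: mult.assoc power_commutes)
    also have "\<dots> = c * (x * (y * x ^ m))" unfolding yx by (simp add: mult.assoc)
    finally have "c * (x * (y * x ^ m)) = 1 * (x * (y * x ^ m))" by simp
    then have "c = 1" using right_cancel_S[of "x * (y * x ^ m)" c 1] xy by simp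
    with c1 show False by simp
  qed
  then have "ord (y * x ^ m) \<ge> ord y" using min[of x "y * x ^ m"] xy by simp
  moreover have "N < ord y" using MN prime_gt_1_nat[OF p(1)] by simp
  ultimately have "c ^ (m * T) \<noteq> 1" using ord_le[of N "y * x ^ m"] MN by fastforce
  then have pmT: "\<not> p dvd m" "\<not> p dvd T" by (auto elim!: dvdE simp: power_mult cp mult.assoc)
      (metis cp mult.left_commute power_mult power_one)
  have TN: "2 * T = N * Suc N" unfolding T_def using gauss_sum_nat[of N] by (simp add: atLeast0AtMost)
  have "b \<noteq> 0"
  proof
    assume "b = 0"
    then have "y = c ^ s" using yN by (simp add: N_def)
    then have "y * x = x * y" using cx by (simp add: power_commuting_commutes)
    with xy show False by simp
  qed
  then have pN: "p dvd N" by (simp add: N_def)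
  have p2: "p = 2"
  proof (rule ccontr)
    assume "p \<noteq> 2"
    then have "coprime p 2" using p(1) by (metis primes_coprime two_is_prime_nat)
    moreover have "p dvd 2 * T" unfolding TN using pN by simp
    ultimately show False using pmT(2) coprime_dvd_mult_right_iff by blast
  qed
  \<comment> \<open>For \<open>N = 2 ^ b\<close> with \<open>b \<ge> 2\<close> the triangular number
    \<open>T\<close> would be even.\<close>
  have b1: "b = 1"
  proof (rule ccontr)
    assume "b \<noteq> 1"
    then obtain b'' where "b = Suc (Suc b'')" using \<open>b \<noteq> 0\<close> by (metis One_nat_def not0_implies_Suc)
    then have "2 * T = 2 * (2 * (2 ^ b'' * Suc N))" unfolding TN by (simp add: N_def p2)
    then have "T = 2 * (2 ^ b'' * Suc N)" by (subst (asm) mult_cancel1) simp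
    then have "p dvd T" unfolding p2 by (rule dvdI)
    then show False using pmT(2) by simp
  qed
  have "a - b = 0"
  proof (rule ccontr)
    assume "a - b \<noteq> 0"
    then have "p dvd m" unfolding m_def by (intro dvd_mult2 dvd_power) auto
    with pmT show False by simp
  qed
  with \<open>b \<le> a\<close> b1 have a1: "a = 1" by simp
  have o: "ord x = 4" "ord y = 4" using ab a1 b1 p2 by simp_all
  have sq: "w ^ (2 * n) = w ^ 2" if "w \<in> S" "ord w = 4" "odd n" for w and n :: nat
  proof -
    have "2 * n mod 4 = (2::nat)" using that(3) by presburger
    then show ?thesis using power_mod_ord[OF that(1), of "2 * n"] that(2) by simp
  qed
  have cx2: "c = x ^ 2" using ci sq[OF xy(1) o(1)] pi a1 p2 by (simp add: M_def)
  moreover have "c = y ^ 2" using j j' sq[OF xy(2) o(2)] pj b1 p2 by (simp add: N_def)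
  ultimately show ?thesis using xy yx c1 o ord(2)[OF xy(1)]
    by (intro bexI[of _ x] bexI[of _ y]) auto
qed

text \<open>Conjugation preserves the order, so it sends \<open>x\<close> to one of the two
  generators \<open>x\<close> and \<open>x ^ 3\<close> of its cyclic group of order 4.\<close>

lemma conj_order_4:
  assumes x: "x \<in> S" "x ^ 4 = 1" "x ^ 2 \<noteq> 1" and g: "g \<in> S"
  shows "\<exists>i\<in>{0, 1::nat}. g * x = (x ^ 2) ^ i * (x * g)"
proof -
  obtain k where "g * x = x ^ k * g" using normal x g by blast
  moreover have "x ^ k = x ^ (k mod 4)"
  proof -
    have "x ^ k = x ^ (4 * (k div 4) + k mod 4)" by simp
    then show ?thesis unfolding power_add power_mult x(2) by simp
  qed
  ultimately have gx: "g * x = x ^ (k mod 4) * g" by simp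
  consider "k mod 4 = 0" | "k mod 4 = 1" | "k mod 4 = 2" | "k mod 4 = 3" by linarith
  then show ?thesis
  proof cases
    case 1
    then have "g * x = g * 1" using gx by simp
    then have "x = 1" using left_cancel_S g by blast
    then show ?thesis using x by simp
  next
    case 2
    then show ?thesis using gx by (intro bexI[of _ 0]) auto
  next
    case 3
    then have gx2: "g * x = x ^ 2 * g" using gx by simp
    have "g * x ^ 2 = g * x * x" by (simp add: power2_eq_square mult.assoc)
    also have "\<dots> = x ^ 2 * (g * x)" by (simp only: gx2 mult.assoc)
    also have "\<dots> = (x ^ 2 * x ^ 2) * g" by (simp only: gx2 mult.assoc)
    also have "x ^ 2 * x ^ 2 = x ^ 4" by (simp flip: power_add)
    finally have "g * x ^ 2 = g * 1" using x by simp
    then show ?thesis using left_cancel_S g x by blast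
  next
    case 4
    then have "g * x = x ^ 2 * (x * g)" using gx by (simp add: mult.assoc numeral_3_eq_3 power2_eq_square)
    then show ?thesis by (intro bexI[of _ 1]) auto
  qed
qed

text \<open>Let \<open>C\<close> be the centralizer of a quaternion pair \<open>x\<close>,
  \<open>y\<close>. Every element conjugates \<open>x\<close> and \<open>y\<close> at most by the
  sign \<open>c\<close>, and some \<open>x ^ i * y ^ j\<close> does the same, so the group is
  covered by four cosets of \<open>C\<close>. As \<open>C\<close> contains no element of order 4, it
  has no quaternion pair of its own and is commutative; hence it is central.\<close>

lemma exists_central_transversal:
  "\<exists>T\<subseteq>S. finite T \<and> card T \<le> 4 \<and>
    (\<forall>g\<in>S. \<exists>t\<in>T. \<exists>z\<in>S. (\<forall>h\<in>S. z * h = h * z) \<and> g = t * z)"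
proof (cases "\<forall>u\<in>S. \<forall>v\<in>S. u * v = v * u")
  case True
  then show ?thesis by (intro exI[of _ "{1}"]) auto
next
  case False
  then obtain x y where x: "x \<in> S" and y: "y \<in> S" and yx: "y * x = x ^ 2 * (x * y)"
    and y2: "y ^ 2 = x ^ 2" and x4: "x ^ 4 = 1" and x2: "x ^ 2 \<noteq> 1"
    using exists_quaternion_pair by blast
  define c where "c = x ^ 2"
  have cS: "c \<in> S" using x by (simp add: c_def)
  have c1: "c \<noteq> 1" and cc: "c * c = 1" using x2 x4 by (simp_all add: c_def flip: power_add)
  have yx: "y * x = c * (x * y)" using yx by (simp add: c_def)
  have y4: "y ^ 4 = 1" "y ^ 2 \<noteq> 1" "y ^ 2 = c"
    using y2 x4 x2 by (simp_all add: c_def) (metis power_mult mult_2 numeral_Bit0)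
  have cx: "c * x = x * c" by (simp add: c_def power_commutes)
  have cy: "c * y = y * c" by (simp add: power_commutes flip: y4(3))
  have xy: "x * y = c * (y * x)" unfolding yx by (simp add: cc flip: mult.assoc)
  have ci: "c ^ i * c ^ i = 1" for i using power_mult_distrib_commuting[of c c i] cc by simp
  define C where "C = {z \<in> S. z * x = x * z \<and> z * y = y * z}"
  have C_D: "z \<in> S" "z * x = x * z" "z * y = y * z" if "z \<in> C" for z
    using that unfolding C_def by blast+
  have gen: "\<exists>i\<in>{0, 1}. \<exists>j\<in>{0, 1}. x ^ i * y ^ j * g \<in> C" if g: "g \<in> S" for g
  proof -
    obtain \<alpha> where \<alpha>: "\<alpha> \<in> {0, 1::nat}" "g * x = c ^ \<alpha> * (x * g)"
      using conj_order_4[OF x x4 x2 g] unfolding c_def by blast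
    obtain \<beta> where \<beta>: "\<beta> \<in> {0, 1::nat}" "g * y = c ^ \<beta> * (y * g)"
      using conj_order_4[OF y y4(1,2) g] unfolding y4(3) by blast
    have pull: "c ^ n * x ^ i = x ^ i * c ^ n" "c ^ n * y ^ i = y ^ i * c ^ n" for n i
      using cx cy by (metis power_commuting_commutes)+
    \<comment> \<open>The exponents are crossed because \<open>y\<close> changes the sign of
      \<open>x\<close> and \<open>x\<close> that of \<open>y\<close>: \<open>y ^ \<alpha>\<close>
      corrects the action of \<open>g\<close> on \<open>x\<close>, and \<open>x ^ \<beta>\<close>
      that on \<open>y\<close>.\<close>
    let ?g = "x ^ \<beta> * y ^ \<alpha> * g"
    have move: "x ^ i * (c ^ n * w) = c ^ n * (x ^ i * w)" "y ^ i * (c ^ n * w) = c ^ n * (y ^ i * w)"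
      "y ^ i * (x * w) = c ^ i * (x * (y ^ i * w))" "x ^ i * (y * w) = c ^ i * (y * (x ^ i * w))"
      "x ^ i * (x * w) = x * (x ^ i * w)" "y ^ i * (y * w) = y * (y ^ i * w)"
      "c ^ i * (c ^ i * w) = w" for i n w
      using ci quasi_commute_power_left[OF yx cy, of i] quasi_commute_power_left[OF xy cx, of i]
      by (simp_all only: mult.assoc[symmetric] pull[of n i] power_commutes mult_1_left)
    have 1: "?g * x = x * ?g" by (simp only: mult.assoc \<alpha>(2) move)
    have 2: "?g * y = y * ?g" by (simp only: mult.assoc \<beta>(2) move)
    have "?g \<in> C" unfolding C_def using 1 2 x y g by simp
    then show ?thesis using \<alpha>(1) \<beta>(1) by blast
  qed
  interpret C: dedekind_group C
  proof
    show "1 \<in> C" by (simp add: C_def)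
    fix u v assume u: "u \<in> C"
    show "\<exists>n>0. u ^ n = 1" using torsion C_D(1)[OF u] .
    assume v: "v \<in> C"
    show "\<exists>k. v * u = u ^ k * v" using normal C_D(1)[OF u] C_D(1)[OF v] .
    have "u * v * x = x * (u * v)" using C_D(2)[OF u] C_D(2)[OF v] by (metis mult.assoc)
    moreover have "u * v * y = y * (u * v)" using C_D(3)[OF u] C_D(3)[OF v] by (metis mult.assoc)
    ultimately show "u * v \<in> C" unfolding C_def using C_D(1)[OF u] C_D(1)[OF v] by simp
  qed
  have no_order_4: False if w: "w \<in> C" "w ^ 4 = 1" "w ^ 2 \<noteq> 1" for w
  proof -
    note wD = C_D[OF w(1)]
    \<comment> \<open>Conjugation by \<open>y\<close> sends \<open>x * w\<close> to
      \<open>c * x * w\<close>, which has to be a power of \<open>x * w\<close>. All four residues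
      of the exponent modulo 4 are excluded; the last one would give
      \<open>w = w ^ 3\<close>.\<close>
    obtain k where k: "y * (x * w) = (x * w) ^ k * y" using normal[of "x * w" y] x y wD by auto
    have xwn: "(x * w) ^ n = x ^ n * w ^ n" for n
      using wD by (intro power_mult_distrib_commuting) simp
    have "(x * w) ^ k = (x * w) ^ (4 * (k div 4) + k mod 4)" by simp
    also have "\<dots> = (x * w) ^ (k mod 4)" unfolding power_add power_mult xwn[of 4] by (simp add: x4 w)
    finally have km: "(x * w) ^ k = x ^ (k mod 4) * w ^ (k mod 4)" by (simp add: xwn)
    have yxw: "y * (x * w) = c * (x * w) * y"
    proof -
      have "y * (x * w) = c * (x * (y * w))" by (simp add: yx flip: mult.assoc)
      then show ?thesis by (simp add: mult.assoc flip: wD(3))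
    qed
    then have eq: "c * (x * w) = x ^ (k mod 4) * w ^ (k mod 4)"
      using k km right_cancel_S[OF y] by metis
    consider "k mod 4 = 0" | "k mod 4 = 1" | "k mod 4 = 2" | "k mod 4 = 3" by linarith
    then show False
    proof cases
      case 1
      then have 11: "c * (x * w) = 1" using eq by simp
      then have "x * w = c" using cc by (metis mult.assoc mult_1_left mult_1_right)
      then have "y * c = 1 * y" using yxw 11 by simp
      then have "c * y = 1 * y" using cy by simp
      then show False using right_cancel_S[OF y] c1 by blast
    next
      case 2
      then have "c * (x * w) = 1 * (x * w)" using eq by simp
      then show False using right_cancel_S[of "x * w" c 1] x wD c1 by simp
    next
      case 3
      then have "c * (x * w) = c * (w * w)" using eq by (simp add: c_def power2_eq_square mult.assoc)
      then have "x * w = w * w" using left_cancel_S cS by blast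
      then have "x = w" using right_cancel_S wD(1) by blast
      then have "1 * (x * y) = c * (x * y)" using wD(3) yx by simp
      then show False using right_cancel_S[of "x * y" 1 c] x y c1 by simp
    next
      case 4
      have "x ^ 3 = c * x" by (simp add: c_def numeral_3_eq_3 power2_eq_square mult.assoc)
      then have "(c * x) * w = (c * x) * w ^ 3" using eq 4 by (simp add: mult.assoc)
      then have w3: "w = w ^ 3" using left_cancel_S[of "c * x" w "w ^ 3"] cS x by simp
      have "w * w ^ 2 = w ^ 3" by (simp add: power3_eq_cube power2_eq_square mult.assoc)
      also have "\<dots> = w * 1" unfolding mult_1_right by (rule w3[symmetric])
      finally show False using left_cancel_S wD(1) w(3) by metis
    qed
  qed
  have C_comm: "u * v = v * u" if "u \<in> C" "v \<in> C" for u v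
  proof (rule ccontr)
    assume "u * v \<noteq> v * u"
    from C.exists_quaternion_pair[OF that this] show False using no_order_4 by blast
  qed
  have central: "z * h = h * z" if z: "z \<in> C" and h: "h \<in> S" for z h
  proof -
    obtain i j where ij: "x ^ i * y ^ j * h \<in> C" using gen[OF h] by blast
    have zx: "z * x ^ i = x ^ i * z" and zy: "z * y ^ j = y ^ j * z"
      using C_D(2,3)[OF z] by (metis power_commuting_commutes)+
    have "x ^ i * y ^ j * (z * h) = x ^ i * (y ^ j * z) * h" by (simp add: mult.assoc)
    also have "\<dots> = z * (x ^ i * y ^ j * h)" unfolding zy[symmetric] by (simp add: zx flip: mult.assoc)
    also have "\<dots> = x ^ i * y ^ j * (h * z)" using C_comm[OF z ij] by (simp add: mult.assoc)
    finally show ?thesis using left_cancel_S[of "x ^ i * y ^ j"] x y by simp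
  qed
  define Q where "Q = (\<lambda>(i, j). x ^ i * y ^ j) ` ({0, 1::nat} \<times> {0, 1::nat})"
  have QS: "Q \<subseteq> S" using x y by (auto simp: Q_def)
  have "finite Q" unfolding Q_def by (intro finite_imageI) simp
  have "card Q \<le> card ({0, 1::nat} \<times> {0, 1::nat})" unfolding Q_def by (rule card_image_le) simp
  then have "card Q \<le> 4" by (simp add: card_cartesian_product)
  define inv_q where "inv_q q = (SOME r. r \<in> S \<and> r * q = 1)" for q
  have inv_q: "inv_q q \<in> S \<and> inv_q q * q = 1" if "q \<in> Q" for q
    unfolding inv_q_def by (rule someI_ex) (use inverse_ex that QS in blast)
  show ?thesis
  proof (intro exI[of _ "inv_q ` Q"] conjI ballI)
    show "card (inv_q ` Q) \<le> 4" using card_image_le[OF \<open>finite Q\<close>, of inv_q] \<open>card Q \<le> 4\<close> by simp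
    fix g assume g: "g \<in> S"
    obtain i j where ij: "i \<in> {0, 1}" "j \<in> {0, 1}" "x ^ i * y ^ j * g \<in> C" using gen[OF g] by blast
    define q where "q = x ^ i * y ^ j"
    have q: "q \<in> Q" unfolding q_def Q_def using ij(1,2) by (intro image_eqI[of _ _ "(i, j)"]) auto
    have "g = inv_q q * q * g" using inv_q[OF q] by simp
    then have gq: "g = inv_q q * (q * g)" by (simp only: mult.assoc)
    have qC: "q * g \<in> C" using ij(3) by (simp only: q_def)
    show "\<exists>t\<in>inv_q ` Q. \<exists>z\<in>S. (\<forall>h\<in>S. z * h = h * z) \<and> g = t * z"
    proof (rule bexI[of _ "inv_q q"], rule bexI[of _ "q * g"], intro conjI ballI)
      show "q * g * h = h * (q * g)" if "h \<in> S" for h using central[OF qC that] .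
    qed (fact gq, fact C_D(1)[OF qC], fact imageI[OF q])
  qed (use inv_q \<open>finite Q\<close> in auto)
qed

end

section \<open>Group algebras\<close>

abbreviation unit_of :: "'g::group_add \<Rightarrow> ('k::field, 'g) group_algebra"
  where "unit_of x \<equiv> Poly_Mapping.single x 1"

lemma unit_of_add: "unit_of (x + y) = unit_of x * unit_of y"
  by (simp add: mult_single)

lemma lookup_ga_scale [simp]: "Poly_Mapping.lookup (ga_scale c a) k = c * Poly_Mapping.lookup a k"
  by (simp add: ga_scale_def Poly_Mapping.map.rep_eq when_def)

lemma ga_scale_eq_mult: "ga_scale c a = Poly_Mapping.single 0 c * a"
  unfolding ga_scale_def by (rule mult_map_scale_conv_mult)

lemma ga_scale_single: "ga_scale c (Poly_Mapping.single x d) = Poly_Mapping.single x (c * d)"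
  by (simp add: ga_scale_eq_mult mult_single)

lemma ga_expand:
  fixes a :: "('k::field, 'g::group_add) group_algebra"
  assumes "finite H" "Poly_Mapping.keys a \<subseteq> H"
  shows "a = (\<Sum>k\<in>H. ga_scale (Poly_Mapping.lookup a k) (unit_of k))"
proof (rule poly_mapping_eqI)
  fix x
  have "(\<Sum>k\<in>H. Poly_Mapping.lookup (ga_scale (Poly_Mapping.lookup a k) (unit_of k)) x)
      = (\<Sum>k\<in>H. if x = k then Poly_Mapping.lookup a k else 0)"
    by (intro sum.cong refl) (simp add: lookup_single when_def)
  also have "\<dots> = Poly_Mapping.lookup a x"
    using assms by (simp add: in_keys_iff subset_iff) (metis in_keys_iff)
  finally show "Poly_Mapping.lookup a x
      = Poly_Mapping.lookup (\<Sum>k\<in>H. ga_scale (Poly_Mapping.lookup a k) (unit_of k)) x"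
    by (simp only: lookup_sum)
qed

lemma single_zero_commute:
  fixes a :: "('k::field, 'g::group_add) group_algebra"
  shows "Poly_Mapping.single 0 c * a = a * Poly_Mapping.single 0 c"
proof -
  note a = ga_expand[OF finite_keys subset_refl, of a]
  show ?thesis
    by (subst (1 2) a) (simp add: sum_distrib_left sum_distrib_right ga_scale_single mult_single mult.commute)
qed

lemma ga_scale_mult:
  fixes x y :: "('k::field, 'g::group_add) group_algebra"
  shows "x * ga_scale c y = ga_scale c (x * y)" "ga_scale c x * y = ga_scale c (x * y)"
  unfolding ga_scale_eq_mult mult.assoc[symmetric] single_zero_commute[of c x] by (rule refl)+

lemma ga_scale_eq_0_iff: "ga_scale c x = 0 \<longleftrightarrow> c = 0 \<or> x = 0"
  by (auto simp: poly_mapping_eq_iff fun_eq_iff)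

lemma vector_space_ga_scale:
  "vector_space (ga_scale :: 'k::field \<Rightarrow> ('k, 'g::group_add) group_algebra \<Rightarrow> _)"
  by unfold_locales (auto intro!: poly_mapping_eqI simp: lookup_add algebra_simps)

lemma sum_const_ga_scale: "(\<Sum>h\<in>H. a) = ga_scale (of_nat (card H)) a"
  by (rule poly_mapping_eqI) (subst lookup_sum, simp)

lemma central_of_commute_units:
  fixes z :: "('k::field, 'g::group_add) group_algebra"
  assumes "\<And>x. z * unit_of x = unit_of x * z"
  shows "z * a = a * z"
proof -
  note a = ga_expand[OF finite_keys subset_refl, of a]
  show ?thesis
    by (subst (1 2) a) (simp add: sum_distrib_left sum_distrib_right ga_scale_mult assms)
qed

text \<open>Maschke's argument: averaging a linear quasi-inverse of \<open>r \<mapsto> r * u\<close> over \<open>H\<close> makes it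
  left \<open>H\<close>-equivariant, hence it is given by right multiplication.\<close>

lemma group_algebra_regular:
  fixes u :: "('k::field, 'g::group_add) group_algebra"
  assumes H: "finite H" "0 \<in> H" "\<And>x y. x \<in> H \<Longrightarrow> y \<in> H \<Longrightarrow> x + y \<in> H" "\<And>x. x \<in> H \<Longrightarrow> - x \<in> H"
    and card: "of_nat (card H) \<noteq> (0::'k)" and u: "Poly_Mapping.keys u \<subseteq> H"
  shows "\<exists>r. Poly_Mapping.keys r \<subseteq> H \<and> u * r * u = u"
proof -
  interpret vector_space "ga_scale :: 'k \<Rightarrow> ('k, 'g) group_algebra \<Rightarrow> _" by (rule vector_space_ga_scale)
  interpret pair: vector_space_pair "ga_scale :: 'k \<Rightarrow> ('k, 'g) group_algebra \<Rightarrow> _"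
    "ga_scale :: 'k \<Rightarrow> ('k, 'g) group_algebra \<Rightarrow> _" by unfold_locales
  define V where "V = {a :: ('k, 'g) group_algebra. Poly_Mapping.keys a \<subseteq> H}"
  have V_iff: "a \<in> V \<longleftrightarrow> (\<forall>k. k \<notin> H \<longrightarrow> Poly_Mapping.lookup a k = 0)" for a
    by (auto simp: V_def in_keys_iff subset_iff)
  have V_sub: "subspace V"
    unfolding subspace_def by (auto simp: V_iff lookup_add)
  have V_unit: "unit_of h \<in> V" if "h \<in> H" for h using that by (auto simp: V_def)
  have V_mult: "a * b \<in> V" if "a \<in> V" "b \<in> V" for a b
    using that keys_mult[of a b] H(3) unfolding V_def by fastforce
  obtain B where B: "B \<subseteq> (\<lambda>a. a * u) ` V" "independent B" "(\<lambda>a. a * u) ` V \<subseteq> span B"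
    using maximal_independent_subset by blast
  define f where "f b = (SOME a. a \<in> V \<and> a * u = b)" for b
  have f: "f b \<in> V \<and> f b * u = b" if "b \<in> B" for b
    unfolding f_def by (rule someI_ex) (use B(1) that in auto)
  \<comment> \<open>A linear section of right multiplication by \<open>u\<close>; prescribing its
    range keeps all its values in \<open>K[H]\<close>.\<close>
  obtain s where s: "Vector_Spaces.linear ga_scale ga_scale s" "\<And>b. b \<in> B \<Longrightarrow> s b = f b" "range s = span (f ` B)"
    using pair.linear_independent_extend_subspace[OF B(2), of f] by blast
  interpret s: Vector_Spaces.linear ga_scale ga_scale s by (rule s(1))
  have sV: "s a \<in> V" for a
    using span_minimal[of "f ` B" V] V_sub f s(3) by blast
  have su: "s w * u = w" if "w \<in> span B" for w
    using that
  proof (induction rule: span_induct_alt)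
    case base
    then show ?case by (simp add: s.zero)
  next
    case (step c x y)
    then show ?case by (simp add: s.add s.scale s(2) f distrib_right ga_scale_mult)
  qed
  define n where "n = inverse (of_nat (card H) :: 'k)"
  define r where "r = ga_scale n (\<Sum>h\<in>H. unit_of (- h) * s (unit_of h))"
  have "r \<in> V" unfolding r_def
    by (intro subspace_scale[OF V_sub] subspace_sum[OF V_sub] V_mult V_unit H(4) sV)
  have unit_r: "unit_of x * r = ga_scale n (\<Sum>h\<in>H. unit_of (- h) * s (unit_of h * unit_of x))"
    if x: "x \<in> H" for x
  proof -
    have "unit_of x * r = ga_scale n (\<Sum>h\<in>H. unit_of (x - h) * s (unit_of h))"
      by (simp add: r_def ga_scale_mult sum_distrib_left mult_single flip: mult.assoc)
    \<comment> \<open>The shift by \<open>x\<close> moves the unit from the left of \<open>s\<close>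
      into its argument: the average is equivariant although \<open>s\<close> is not.\<close>
    also have "(\<Sum>h\<in>H. unit_of (x - h) * s (unit_of h)) = (\<Sum>h\<in>H. unit_of (- h) * s (unit_of h * unit_of x))"
    proof (rule sum.reindex_bij_witness[of _ "\<lambda>h. h + x" "\<lambda>h. h - x"])
      fix h assume "h \<in> H"
      then show "h - x \<in> H" "h + x \<in> H" using H(3)[of h x] H(3)[of h "- x"] H(4) x by simp_all
    qed (simp_all add: mult_single)
    finally show ?thesis .
  qed
  have "u * r = (\<Sum>x\<in>H. ga_scale (Poly_Mapping.lookup u x) (unit_of x * r))"
    by (subst ga_expand[OF H(1) u]) (simp add: sum_distrib_right ga_scale_mult)
  also have "\<dots> = (\<Sum>x\<in>H. \<Sum>h\<in>H. ga_scale n (unit_of (- h) *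
      s (unit_of h * ga_scale (Poly_Mapping.lookup u x) (unit_of x))))"
    by (simp add: unit_r ga_scale_mult s.scale scale_sum_right mult.commute)
  also have "\<dots> = ga_scale n (\<Sum>h\<in>H. unit_of (- h) *
      s (unit_of h * (\<Sum>x\<in>H. ga_scale (Poly_Mapping.lookup u x) (unit_of x))))"
    by (subst sum.swap) (simp add: s.sum sum_distrib_left scale_sum_right)
  also have "\<dots> = ga_scale n (\<Sum>h\<in>H. unit_of (- h) * s (unit_of h * u))"
    by (simp only: ga_expand[OF H(1) u, symmetric])
  finally have "u * r * u = ga_scale n (\<Sum>h\<in>H. unit_of (- h) * (s (unit_of h * u) * u))"
    by (simp add: ga_scale_mult sum_distrib_right mult.assoc)
  also have "\<dots> = ga_scale n (\<Sum>h\<in>H. unit_of (- h) * (unit_of h * u))"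
    using B(3) V_unit by (intro arg_cong[where f = "ga_scale n"] sum.cong refl) (simp add: su image_subset_iff)
  also have "\<dots> = ga_scale n (\<Sum>h\<in>H. u)"
    by (simp add: mult_single flip: mult.assoc)
  also have "\<dots> = u"
    using card unfolding sum_const_ga_scale by (intro poly_mapping_eqI) (simp add: n_def)
  finally show ?thesis using \<open>r \<in> V\<close> by (auto simp: V_def)
qed

text \<open>Sylow's theorem with exponent 1 serves as Cauchy's theorem: if the characteristic is a
  prime dividing the order of \<open>H\<close>, some element has that order. In characteristic 0 it
  suffices that \<open>H\<close> is nonempty.\<close>

lemma of_nat_card_subgroup_neq_0:
  assumes G: "group G" and p: "p_prime_group CHAR('k::field) G"
    and H: "subgroup H G" "finite H"
  shows "of_nat (card H) \<noteq> (0::'k)"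
proof
  interpret G: group G by fact
  interpret H: subgroup H G by fact
  assume "of_nat (card H) = (0::'k)"
  then have dvd: "CHAR('k) dvd card H" by (simp add: of_nat_eq_0_iff_char_dvd)
  have "card H > 0" using H H.one_closed card_gt_0_iff by blast
  then have pos: "CHAR('k) > 0" using dvd by (cases "CHAR('k) = 0") auto
  then have prime: "prime CHAR('k)" by (rule prime_CHAR_semidom)
  let ?H = "G\<lparr>carrier := H\<rparr>"
  have grp: "group ?H" by (rule H.subgroup_is_group[OF G])
  obtain m where "Coset.order ?H = CHAR('k) ^ 1 * m" using dvd by (auto simp: Coset.order_def)
  then obtain P where P: "subgroup P ?H" "card P = CHAR('k) ^ 1"
    using sylow_thm[OF prime grp, of 1 m] H(2) by auto
  have "\<not> P \<subseteq> {\<one>\<^bsub>G\<^esub>}"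
  proof
    assume "P \<subseteq> {\<one>\<^bsub>G\<^esub>}"
    then have "card P \<le> card {\<one>\<^bsub>G\<^esub>}" by (intro card_mono) simp_all
    then show False using P(2) prime_gt_1_nat[OF prime] by simp
  qed
  then obtain x where x: "x \<in> P" "x \<noteq> \<one>\<^bsub>G\<^esub>" by blast
  have "x \<in> H" using x(1) subgroup.subset[OF P(1)] by auto
  then have xG: "x \<in> carrier G" by (rule H.mem_carrier)
  let ?P = "?H\<lparr>carrier := P\<rparr>"
  have grpP: "group ?P" by (rule subgroup.subgroup_is_group[OF P(1) grp])
  have "x [^]\<^bsub>?P\<^esub> Coset.order ?P = \<one>\<^bsub>?P\<^esub>"
    using group.pow_order_eq_1[OF grpP, of x] x(1) by simp
  then have "x [^]\<^bsub>G\<^esub> CHAR('k) = \<one>\<^bsub>G\<^esub>"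
    using P(2) by (simp add: Coset.order_def nat_pow_def)
  then have "G.ord x dvd CHAR('k)" using G.pow_eq_id[OF xG] by simp
  moreover have "G.ord x \<noteq> 1" using x(2) G.ord_eq_1[OF xG] by simp
  ultimately have "G.ord x = CHAR('k)" using prime unfolding prime_nat_iff by blast
  then show False using p xG by (auto simp: p_prime_group_def)
qed

section \<open>Finite subgroups of the given group and local regularity\<close>

lemma type_group_simps [simp]:
  "carrier type_group = UNIV" "x \<otimes>\<^bsub>type_group\<^esub> y = x + y" "\<one>\<^bsub>type_group\<^esub> = 0"
  by (simp_all add: type_group_def)

lemma inv_type_group [simp]: "inv\<^bsub>type_group\<^esub> x = - (x :: 'g::group_add)"
  by (rule group.inv_equality[OF group_type_group]) auto

lemma unit_of_pow: "unit_of (x [^]\<^bsub>type_group\<^esub> (n::nat)) = (unit_of x :: ('k::field, 'g::group_add) group_algebra) ^ n"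
proof (induction n)
  case (Suc n)
  have "unit_of (x [^]\<^bsub>type_group\<^esub> Suc n) = (unit_of (x [^]\<^bsub>type_group\<^esub> n) * unit_of x :: ('k, 'g) group_algebra)"
    by (simp add: mult_single)
  then show ?case by (simp only: Suc power_Suc2)
qed simp

locale locally_finite_p_prime =
  fixes K :: "'k::field itself" and G :: "'g::group_add itself"
  assumes locally_finite: "locally_finite_group (type_group :: 'g monoid)"
    and p_prime: "p_prime_group CHAR('k) (type_group :: 'g monoid)"
begin

lemma finite_subgroup:
  fixes X :: "'g set"
  assumes "finite X"
  defines "H \<equiv> generate type_group X"
  shows "finite H" "X \<subseteq> H" "0 \<in> H" "\<And>x y. x \<in> H \<Longrightarrow> y \<in> H \<Longrightarrow> x + y \<in> H"
    "\<And>x. x \<in> H \<Longrightarrow> - x \<in> H" "of_nat (card H) \<noteq> (0::'k)"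
proof -
  interpret group "type_group :: 'g monoid" by (rule group_type_group)
  show fin: "finite H" using locally_finite assms(1) unfolding H_def locally_finite_group_def by simp
  have sub: "subgroup H type_group" unfolding H_def by (rule generate_is_subgroup) simp
  interpret subgroup H type_group by fact
  show "X \<subseteq> H" unfolding H_def by (auto intro: generate.incl)
  show "0 \<in> H" using one_closed by simp
  show "x + y \<in> H" if "x \<in> H" "y \<in> H" for x y using m_closed[OF that] by simp
  show "- x \<in> H" if "x \<in> H" for x using m_inv_closed[OF that] by simp
  show "of_nat (card H) \<noteq> (0::'k)"
    by (rule of_nat_card_subgroup_neq_0[OF group_type_group p_prime sub fin])
qed

lemma regular:
  fixes u :: "('k, 'g) group_algebra"
  shows "\<exists>r. u * r * u = u"
  using group_algebra_regular[OF finite_subgroup(1,3-6)[OF finite_keys[of u]]]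
    finite_subgroup(2)[OF finite_keys[of u]] by blast

section \<open>The property for finite and for infinite coefficient fields\<close>

context
  fixes g :: "'k poly"
  assumes g: "g \<noteq> 0"
    and P1: "property_P1 (ga_scale :: 'k \<Rightarrow> ('k, 'g) group_algebra \<Rightarrow> _) g"
begin

lemma standard_identity_finite_field:
  assumes K: "finite (UNIV :: 'k set)"
  shows "satisfies_standard_identity TYPE(('k, 'g) group_algebra)"
  unfolding satisfies_standard_identity_def
proof (intro exI conjI allI)
  let ?N = "Suc ((2 * Polynomial.degree g) * (2 * Polynomial.degree g))"
  show "1 \<le> ?N" by simp
  fix a :: "nat \<Rightarrow> ('k, 'g) group_algebra"
  define X where "X = (\<Union>i\<in>{1..?N}. Poly_Mapping.keys (a i))"
  define H where "H = generate type_group X"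
  have "finite X" by (simp add: X_def)
  note H = finite_subgroup[OF \<open>finite X\<close>, folded H_def]
  define A where "A = {u :: ('k, 'g) group_algebra. Poly_Mapping.keys u \<subseteq> H}"
  have A_iff: "u \<in> A \<longleftrightarrow> (\<forall>k. k \<notin> H \<longrightarrow> Poly_Mapping.lookup u k = 0)" for u
    by (auto simp: A_def in_keys_iff subset_iff)
  have "inj_on (\<lambda>u. restrict (Poly_Mapping.lookup u) H) A"
  proof (rule inj_onI)
    fix u v assume u: "u \<in> A" and v: "v \<in> A"
      and eq: "restrict (Poly_Mapping.lookup u) H = restrict (Poly_Mapping.lookup v) H"
    show "u = v"
    proof (rule poly_mapping_eqI)
      fix k
      show "Poly_Mapping.lookup u k = Poly_Mapping.lookup v k"
        using fun_cong[OF eq, of k] u v by (cases "k \<in> H") (auto simp: A_iff)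
    qed
  qed
  moreover have "finite ((\<lambda>u. restrict (Poly_Mapping.lookup u) H) ` A)"
    by (rule finite_subset[of _ "PiE H (\<lambda>_. UNIV)"]) (use H(1) K in \<open>auto intro: finite_PiE\<close>)
  ultimately have fin: "finite A" by (rule finite_imageD[rotated])
  interpret finite_regular_subring A
  proof
    show "x * y \<in> A" if "x \<in> A" "y \<in> A" for x y
      using that keys_mult[of x y] H(4) unfolding A_def by fastforce
    show "\<exists>r\<in>A. x * r * x = x" if "x \<in> A" for x
      using group_algebra_regular[OF H(1,3-6), of x] that by (auto simp: A_def)
    show "1 \<in> A" using H(3) by (simp add: A_def)
    show "x - y \<in> A" if "x \<in> A" "y \<in> A" for x y
      using that by (simp add: A_iff lookup_minus)
  qed (rule fin)
  show "standard_poly ?N a = 0"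
  proof (rule standard_poly_eq_0[OF P1 g ga_scale_mult ga_scale_eq_0_iff])
    fix i assume "i \<in> {1..?N}"
    then have "Poly_Mapping.keys (a i) \<subseteq> X" unfolding X_def by blast
    then show "a i \<in> A" using H(2) by (auto simp: A_def)
  qed simp
qed

text \<open>For a fixed basis element \<open>k\<close>, the coefficient of \<open>g (t a b)\<close>
  at \<open>k\<close> is a polynomial in \<open>t\<close> with infinitely many zeros. Its top
  coefficient is that of \<open>g\<close> times the coefficient of \<open>(a * b) ^ d\<close> at
  \<open>k\<close>.\<close>

lemma square_zero_mult_nilpotent:
  fixes a b :: "('k, 'g) group_algebra"
  assumes K: "infinite (UNIV :: 'k set)" and a: "a ^ 2 = 0" and b: "b ^ 2 = 0"
  shows "(a * b) ^ Polynomial.degree g = 0"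
proof (rule poly_mapping_eqI)
  fix k
  define d where "d = Polynomial.degree g"
  define q where "q = (\<Sum>i\<le>d. monom (Polynomial.coeff g i * Poly_Mapping.lookup ((a * b) ^ i) k) i)"
  have "poly q t = 0" for t
  proof -
    have pow: "(ga_scale t (a * b)) ^ i = ga_scale (t ^ i) ((a * b) ^ i)" for i
    proof (induction i)
      case 0
      then show ?case by (simp add: ga_scale_eq_mult)
    next
      case (Suc i)
      then show ?case by (simp add: ga_scale_mult) (simp add: ga_scale_eq_mult mult_single mult.commute flip: mult.assoc)
    qed
    have "(ga_scale t a) ^ 2 = 0"
      using a by (simp add: power2_eq_square ga_scale_mult ga_scale_eq_0_iff)
    then have "alg_poly ga_scale g (ga_scale t a * b) = 0"
      using P1 b unfolding property_P1_def by blast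
    then have "Poly_Mapping.lookup (alg_poly ga_scale g (ga_scale t (a * b))) k = 0"
      by (simp add: ga_scale_mult)
    then show ?thesis
      by (simp add: alg_poly_def pow lookup_sum q_def d_def poly_sum poly_monom mult_ac)
  qed
  then have "q = 0" using poly_roots_finite[of q] K by auto
  then have "Polynomial.coeff q d = 0" by simp
  then have "Polynomial.coeff g d * Poly_Mapping.lookup ((a * b) ^ d) k = 0"
    by (simp add: q_def coeff_sum)
  then show "Poly_Mapping.lookup ((a * b) ^ Polynomial.degree g) k = Poly_Mapping.lookup 0 k"
    using g by (simp add: d_def)
qed

text \<open>If \<open>u = e x (1 - e) = u r u\<close>, then \<open>u\<close> and \<open>b = (1 - e) r e\<close> square to zero but
  \<open>(u b) u = u\<close>, so that \<open>u b\<close> can only be nilpotent if \<open>u = 0\<close>.\<close>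

lemma idempotent_absorbs:
  fixes e x :: "('k, 'g) group_algebra"
  assumes K: "infinite (UNIV :: 'k set)" and e: "e * e = e"
  shows "e * x = e * x * e"
proof -
  define u where "u = e * x * (1 - e)"
  obtain r where r: "u * r * u = u" using regular by blast
  define b where "b = (1 - e) * r * e"
  have ee: "(1 - e) * e = 0" "e * (1 - e) = 0" using e by (simp_all add: algebra_simps)
  have ue: "u * (1 - e) = u" "e * u = u"
    using e ee by (simp_all add: u_def algebra_simps flip: mult.assoc) (simp add: mult.assoc e)
  have "u * u = e * x * ((1 - e) * e) * (x * (1 - e))" by (simp only: u_def mult.assoc)
  then have uu: "u ^ 2 = 0" by (simp add: ee power2_eq_square)
  have "b * b = (1 - e) * r * (e * (1 - e)) * (r * e)" by (simp only: b_def mult.assoc)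
  then have bb: "b ^ 2 = 0" by (simp add: ee power2_eq_square)
  have "u * b = u * r * e" unfolding b_def mult.assoc[symmetric] ue by (rule refl)
  then have ubu: "u * b * u = u" using r ue by (simp add: mult.assoc)
  have "(u * b) ^ n * u = u" for n
  proof (induction n)
    case (Suc n)
    then show ?case by (simp only: power_Suc2 mult.assoc ubu[unfolded mult.assoc])
  qed simp
  then have "u = 0" using square_zero_mult_nilpotent[OF K uu bb] by (metis mult_zero_left)
  moreover have "u = e * x - e * x * e" by (simp add: u_def right_diff_distrib)
  ultimately show ?thesis by simp
qed

text \<open>Absorption for \<open>e\<close> gives \<open>e * x = e * x * e\<close>, and for the
  complementary idempotent \<open>1 - e\<close> it gives \<open>x * e = e * x * e\<close>.\<close>

lemma idempotent_central:
  fixes e x :: "('k, 'g) group_algebra"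
  assumes K: "infinite (UNIV :: 'k set)" and e: "e * e = e"
  shows "e * x = x * e"
proof -
  have "(1 - e) * (1 - e) = 1 - e" using e by (simp add: algebra_simps)
  from idempotent_absorbs[OF K this, of x] have "x * e = e * x * e" by (simp add: algebra_simps)
  with idempotent_absorbs[OF K e, of x] show ?thesis by simp
qed

text \<open>The average \<open>e\<close> of the cyclic group \<open>H\<close> of \<open>x\<close> is
  idempotent, hence central. Comparing the supports of \<open>e\<close> times \<open>y\<close> and
  \<open>y\<close> times \<open>e\<close> shows that \<open>y\<close> normalizes
  \<open>H\<close>.\<close>

lemma dedekind_group_units:
  assumes K: "infinite (UNIV :: 'k set)"
  shows "dedekind_group (range (unit_of :: 'g \<Rightarrow> ('k, 'g) group_algebra))"
proof
  interpret group "type_group :: 'g monoid" by (rule group_type_group)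
  let ?U = "unit_of :: 'g \<Rightarrow> ('k, 'g) group_algebra"
  show "1 \<in> range ?U" by (metis rangeI single_one)
  show "x * y \<in> range ?U" if "x \<in> range ?U" "y \<in> range ?U" for x y
    using that by (auto simp: mult_single)
  have torsion: "\<exists>n::nat. n > 0 \<and> x [^]\<^bsub>type_group\<^esub> n = 0" for x :: 'g
    using p_prime by (auto simp: p_prime_group_def torsion_group_def)
  show "\<exists>n>0. u ^ n = 1" if u: "u \<in> range ?U" for u
  proof -
    obtain x where x: "u = ?U x" using u by blast
    obtain n :: nat where "n > 0" "x [^]\<^bsub>type_group\<^esub> n = 0" using torsion by blast
    then show ?thesis using unit_of_pow[of x n, where 'k = 'k] unfolding x by (intro exI[of _ n]) simp
  qed
  show "\<exists>k. v * u = u ^ k * v" if u: "u \<in> range ?U" and v: "v \<in> range ?U" for u v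
  proof -
    obtain x y where x: "u = ?U x" and y: "v = ?U y" using u v by blast
    define H where "H = generate type_group {x}"
    note H = finite_subgroup[of "{x}", folded H_def, simplified]
    define s where "s = (\<Sum>h\<in>H. ?U h)"
    define e where "e = ga_scale (inverse (of_nat (card H))) s"
    have "?U h * s = s" if h: "h \<in> H" for h
    proof -
      have "?U h * s = (\<Sum>k\<in>H. ?U (h + k))" by (simp add: s_def sum_distrib_left mult_single)
      also have "\<dots> = s" unfolding s_def
        by (rule sum.reindex_bij_witness[of _ "\<lambda>k. - h + k" "\<lambda>k. h + k"])
          (use h H(4,5) in \<open>auto simp flip: add.assoc\<close>)
      finally show ?thesis .
    qed
    then have "s * s = (\<Sum>h\<in>H. s)" by (subst (1) s_def) (simp add: sum_distrib_right)
    also have "\<dots> = ga_scale (of_nat (card H)) s"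
      by (rule sum_const_ga_scale)
    finally have "e * e = e"
      using H(6) by (intro poly_mapping_eqI) (simp add: e_def ga_scale_mult)
    then have "e * ?U y = ?U y * e" using idempotent_central[OF K] by blast
    then have "s * ?U y = ?U y * s"
      using H(6) by (simp add: e_def ga_scale_mult poly_mapping_eq_iff fun_eq_iff)
    then have "(\<Sum>h\<in>H. ?U (h + y)) = (\<Sum>h\<in>H. ?U (y + h))"
      by (simp add: s_def sum_distrib_left sum_distrib_right mult_single)
    \<comment> \<open>At \<open>y + x\<close> the right side has coefficient 1, coming from
      \<open>h = x\<close> alone; so some \<open>h + y\<close> on the left must equal
      \<open>y + x\<close>.\<close>
    then have "Poly_Mapping.lookup (\<Sum>h\<in>H. ?U (h + y)) (y + x) = Poly_Mapping.lookup (\<Sum>h\<in>H. ?U (y + h)) (y + x)"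
      by simp
    also have "\<dots> = (\<Sum>h\<in>H. if h = x then 1 else 0)"
      unfolding lookup_sum by (intro sum.cong refl) (simp add: lookup_single when_def)
    also have "\<dots> = 1" using H(1,2) by simp
    finally have "(\<Sum>h\<in>H. Poly_Mapping.lookup (?U (h + y)) (y + x)) \<noteq> 0" by (simp add: lookup_sum)
    then obtain h where "h \<in> H" "Poly_Mapping.lookup (?U (h + y)) (y + x) \<noteq> 0"
      using sum.not_neutral_contains_not_neutral by blast
    then have h: "h \<in> H" "h + y = y + x" by (auto simp: lookup_single when_def split: if_splits)
    obtain n :: nat where n: "n > 0" "x [^]\<^bsub>type_group\<^esub> n = 0" using torsion by blast
    have "ord x \<noteq> 0" using n pow_eq_id[of x n] by auto
    then obtain k :: nat where "h = x [^]\<^bsub>type_group\<^esub> k"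
      using h(1) generate_pow_nat[of x] unfolding H_def by auto
    then have "?U y * ?U x = ?U x ^ k * ?U y"
      unfolding unit_of_pow[symmetric] unit_of_add[symmetric] using h(2) by simp
    then show ?thesis unfolding x y by blast
  qed
qed

lemma standard_identity_infinite_field:
  assumes K: "infinite (UNIV :: 'k set)"
  shows "satisfies_standard_identity TYPE(('k, 'g) group_algebra)"
proof -
  let ?U = "unit_of :: 'g \<Rightarrow> ('k, 'g) group_algebra"
  interpret dedekind_group "range ?U" by (rule dedekind_group_units[OF K])
  obtain T where T: "finite T" "card T \<le> 4"
    "\<And>u. u \<in> range ?U \<Longrightarrow> \<exists>t\<in>T. \<exists>z\<in>range ?U. (\<forall>h\<in>range ?U. z * h = h * z) \<and> u = t * z"
    using exists_central_transversal by blast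
  have "\<forall>x. \<exists>t z. t \<in> T \<and> (\<forall>w. z * w = w * z) \<and> ?U x = t * z"
  proof
    fix x
    obtain t z where tz: "t \<in> T" "\<forall>h\<in>range ?U. z * h = h * z" "?U x = t * z"
      using T(3)[of "?U x"] by blast
    have "z * w = w * z" for w by (rule central_of_commute_units, rule bspec[OF tz(2)], rule rangeI)
    with tz(1,3) show "\<exists>t z. t \<in> T \<and> (\<forall>w. z * w = w * z) \<and> ?U x = t * z" by blast
  qed
  then obtain t z where tz: "\<And>x. t x \<in> T" "\<And>x w. z x * w = w * z x" "\<And>x. ?U x = t x * z x"
    unfolding choice_iff by blast
  have "standard_poly 5 a = 0" for a :: "nat \<Rightarrow> ('k, 'g) group_algebra"
  proof -
    \<comment> \<open>The central coefficient of the representative \<open>s\<close> in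
      \<open>a i\<close>, obtained by grouping the support of \<open>a i\<close> by
      representatives.\<close>
    define y where "y i s = (\<Sum>x\<in>{x \<in> Poly_Mapping.keys (a i). t x = s}. ga_scale (Poly_Mapping.lookup (a i) x) (z x))" for i s
    have y: "y i s * w = w * y i s" for i s w
      unfolding y_def sum_distrib_left sum_distrib_right ga_scale_mult tz(2)[of _ w] by (rule refl)
    show ?thesis
    proof (rule standard_poly_eq_0_of_central_span[where T = T and b = "\<lambda>s. s" and z = y])
      show "card T < 5" using T(2) by simp
      fix i
      have "a i = (\<Sum>x\<in>Poly_Mapping.keys (a i). ga_scale (Poly_Mapping.lookup (a i) x) (?U x))"
        by (rule ga_expand[OF finite_keys subset_refl])
      also have "\<dots> = (\<Sum>s\<in>T. \<Sum>x\<in>{x \<in> Poly_Mapping.keys (a i). t x = s}. ga_scale (Poly_Mapping.lookup (a i) x) (?U x))"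
        by (rule sum.group[symmetric]) (use T(1) tz(1) in auto)
      also have "\<dots> = (\<Sum>s\<in>T. s * y i s)"
        by (intro sum.cong refl) (simp add: y_def sum_distrib_left ga_scale_mult tz(3))
      finally show "a i = (\<Sum>s\<in>T. s * y i s)" .
    qed (rule T(1), rule y[symmetric], rule y)
  qed
  then show ?thesis unfolding satisfies_standard_identity_def by (intro exI[of _ 5]) simp
qed

end

end

theorem proposition1p4:
  fixes p :: nat
  assumes "p = CHAR('k::field)"
    and "locally_finite_group (type_group :: 'g::group_add monoid)"
    and "p_prime_group p (type_group :: 'g monoid)"
    and "\<exists>g :: 'k poly. g \<noteq> 0 \<and>
      property_P1 (ga_scale :: 'k \<Rightarrow> ('k, 'g) group_algebra \<Rightarrow> ('k, 'g) group_algebra) g"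
  shows "satisfies_standard_identity TYPE(('k, 'g) group_algebra)"
proof -
  interpret locally_finite_p_prime "TYPE('k)" "TYPE('g)"
    by unfold_locales (use assms in auto)
  show ?thesis
    using assms(4) standard_identity_finite_field standard_identity_infinite_field by blast
qed

end
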